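(* If $\alpha$ is a Pisot number whose three conjugates $\alpha_1,\alpha_2,\alpha_3$ over $\mathbb{Q}$ satisfy $$\alpha_1+\alpha_2+\alpha_3=0,$$ then $\alpha$ is Siegel's number $\theta=1.32471\dots$, the real root of $x^3-x-1=0$. Furthermore, there does not exist a Pisot number $\alpha$ whose three conjugates $\alpha_1,\alpha_2,\alpha_3$ over $\mathbb{Q}$ satisfy $$\alpha_1=\alpha_2+\alpha_3.$$
   Context: A Pisot number is a real algebraic integer $\alpha>1$ all of whose conjugates over $\mathbb{Q}$, other than $\alpha$ itself, lie in the open unit disc $|z|<1$. The conjugates of $\alpha$ are the roots of its minimal polynomial over $\mathbb{Q}$ (including $\alpha$ itself). *)

theory Defs
  imports Complex_Main "HOL-Computational_Algebra.Computational_Algebra"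
begin

definition min_poly_over_Q :: "'a :: field_char_0 \<Rightarrow> rat poly" where
  "min_poly_over_Q x = (THE p. lead_coeff p = 1 \<and> poly (map_poly of_rat p) x = 0 \<and>
     (\<forall>q. q \<noteq> 0 \<and> poly (map_poly of_rat q) x = 0 \<longrightarrow> degree p \<le> degree q))"

text \<open>The description is well-defined for every algebraic number; otherwise
  \<^const>\<open>min_poly_over_Q\<close> is unspecified.\<close>

lemma min_poly_over_Q_ex1:
  fixes x :: "'a :: field_char_0"
  assumes "algebraic x"
  shows "\<exists>!p. lead_coeff p = 1 \<and> poly (map_poly of_rat p) x = 0 \<and>
     (\<forall>q. q \<noteq> 0 \<and> poly (map_poly of_rat q) x = 0 \<longrightarrow> degree p \<le> degree q)"
proof -
  let ?R = "\<lambda>q :: rat poly. poly (map_poly of_rat q) x = 0"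
  let ?P = "\<lambda>q :: rat poly. q \<noteq> 0 \<and> ?R q"
  have R_diff: "?R (p - q)" if "?R p" "?R q" for p q
  proof -
    have "map_poly of_rat (p - q) = (map_poly of_rat p - map_poly of_rat q :: 'a poly)"
      by (intro poly_eqI) (simp add: coeff_map_poly of_rat_diff)
    thus ?thesis using that by simp
  qed
  have R_smult: "?R (smult c p)" if "?R p" for c p
  proof -
    have "map_poly of_rat (smult c p) = (smult (of_rat c) (map_poly of_rat p) :: 'a poly)"
      by (intro poly_eqI) (simp add: coeff_map_poly of_rat_mult)
    thus ?thesis using that by simp
  qed
  obtain f :: "'a poly" where f: "\<forall>i. coeff f i \<in> \<rat>" "poly f x = 0" "f \<noteq> 0"
    using assms by (auto simp: algebraic_altdef)
  have "\<exists>g :: nat \<Rightarrow> rat. \<forall>i. coeff f i = of_rat (g i)"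
    using f(1) by (intro choice) (auto elim: Rats_cases)
  then obtain g :: "nat \<Rightarrow> rat" where g: "\<And>i. coeff f i = of_rat (g i)" by blast
  have "coeff (Abs_poly g) = g"
  proof (rule Abs_poly_inverse, safe)
    have "g n = 0 \<longleftrightarrow> coeff f n = 0" for n by (simp add: g)
    thus "\<forall>\<^sub>\<infinity>n. g n = 0" using MOST_coeff_eq_0[of f] by simp
  qed
  hence gf: "map_poly of_rat (Abs_poly g) = f"
    by (intro poly_eqI) (simp add: coeff_map_poly g)
  have "?P (Abs_poly g)" using f(2,3) gf by auto
  then obtain p0 where p0: "?P p0" "\<And>q. ?P q \<Longrightarrow> degree p0 \<le> degree q"
    using ex_has_least_nat[of ?P _ degree] by blast
  define p where "p = smult (inverse (lead_coeff p0)) p0"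
  have p: "lead_coeff p = 1" "?R p" "degree p = degree p0"
    using p0(1) R_smult by (auto simp: p_def)
  show ?thesis
  proof (intro ex1I[of _ p] conjI allI impI)
    show "degree p \<le> degree q" if "?P q" for q using p0(2)[OF that] p(3) by simp
  next
    fix q :: "rat poly"
    assume q: "lead_coeff q = 1 \<and> ?R q \<and> (\<forall>r. ?P r \<longrightarrow> degree q \<le> degree r)"
    have [simp]: "p \<noteq> 0" "q \<noteq> 0" using p(1) q by auto
    have deg: "degree q = degree p"
      using q p p0 p0(2)[of q] by (metis \<open>p \<noteq> 0\<close> \<open>q \<noteq> 0\<close> le_antisym)
    show "q = p"
    proof (rule ccontr)
      assume "q \<noteq> p"
      hence d0: "q - p \<noteq> 0" by simp
      have c: "coeff (q - p) (degree p) = 0" using deg q p(1) by simp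
      have le: "degree (q - p) \<le> degree p" using deg by (intro degree_diff_le) auto
      have "degree (q - p) \<noteq> degree p"
        using c d0 by (metis leading_coeff_0_iff)
      hence "degree (q - p) < degree p" using le by simp
      moreover have "degree p \<le> degree (q - p)"
        using p0(2)[of "q - p"] R_diff[of q p] d0 q p by auto
      ultimately show False by simp
    qed
  qed (use p in auto)
qed

definition conjugates_over_Q :: "complex \<Rightarrow> complex set" where
  "conjugates_over_Q x = {z. poly (map_poly of_rat (min_poly_over_Q x)) z = 0}"

definition Pisot_number :: "real \<Rightarrow> bool" where
  "Pisot_number \<alpha> \<longleftrightarrow> algebraic_int \<alpha> \<and> \<alpha> > 1 \<and>
     (\<forall>z \<in> conjugates_over_Q (of_real \<alpha>). z \<noteq> of_real \<alpha> \<longrightarrow> norm z < 1)"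

definition Siegel_number :: real where
  "Siegel_number = (THE x. x ^ 3 - x - 1 = 0)"

lemma Siegel_number_unique_root: "\<exists>!x :: real. x ^ 3 - x - 1 = 0"
proof -
  let ?f = "\<lambda>x :: real. x ^ 3 - x - 1"
  have "\<exists>x \<ge> 1. x \<le> 2 \<and> ?f x = 0"
    by (rule IVT') (auto intro!: continuous_intros)
  then obtain x where x: "?f x = 0" by blast
  have gt: "y > 1" if "?f y = 0" for y
  proof (rule ccontr)
    assume "\<not> y > 1"
    hence "y \<le> 1" by simp
    have *: "y * (y - 1) * (y + 1) = 1" using that by (simp add: algebra_simps power3_eq_cube)
    consider "y \<le> -1" | "-1 < y" "y \<le> 0" | "0 < y" by linarith
    thus False
    proof cases
      case 1
      hence "(y * (y - 1)) * (y + 1) \<le> 0"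
        by (intro mult_nonneg_nonpos mult_nonpos_nonpos) auto
      thus False using * by simp
    next
      case 2
      have "y ^ 3 = y * y * y" by (simp add: power3_eq_cube)
      also have "\<dots> \<le> 0" using 2 by (intro mult_nonneg_nonpos mult_nonpos_nonpos) auto
      finally show False using that 2 by linarith
    next
      case 3
      hence "(y * (y - 1)) * (y + 1) \<le> 0"
        using \<open>y \<le> 1\<close> by (intro mult_nonpos_nonneg mult_nonneg_nonpos) auto
      thus False using * by simp
    qed
  qed
  have "y = x" if "?f y = 0" for y
  proof (rule ccontr)
    assume "y \<noteq> x"
    have "(y - x) * (y\<^sup>2 + x * y + x\<^sup>2 - 1) = 0"
      using that x by (simp add: algebra_simps power2_eq_square power3_eq_cube)
    moreover have "y\<^sup>2 > 1" "x\<^sup>2 > 1" "x * y > 0"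
      using gt[OF that] gt[OF x] by (auto simp: one_less_power)
    ultimately show False using \<open>y \<noteq> x\<close> by simp
  qed
  with x show ?thesis by blast
qed

lemma Siegel_number_bounds: "1.32471 \<le> Siegel_number" "Siegel_number < 1.32472"
proof -
  let ?f = "\<lambda>x :: real. x ^ 3 - x - 1"
  have "\<exists>x \<ge> 1.32471. x \<le> 1.32472 \<and> ?f x = 0"
    by (rule IVT') (auto intro!: continuous_intros simp: power3_eq_cube)
  then obtain x where x: "1.32471 \<le> x" "x \<le> 1.32472" "?f x = 0" by blast
  have "Siegel_number = x"
    unfolding Siegel_number_def using Siegel_number_unique_root x(3) by (rule the1_equality)
  moreover have "x \<noteq> 1.32472"
  proof
    assume "x = 1.32472"
    thus False using x(3) by (simp only: power3_eq_cube) simp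
  qed
  ultimately show "1.32471 \<le> Siegel_number" "Siegel_number < 1.32472" using x by auto
qed

end

theory Submission
  imports Defs "Jordan_Normal_Form.Char_Poly"
begin

text \<open>
  Write both relations as b + c = e a with e = -1 or e = 1, and let T be the set of all such triples of
  conjugates. The Galois group acts on T and transitively on the conjugates, so every conjugate occurs
  equally often, say n times, in each of the three positions. Hence the trace of \<alpha> is 0, and
  the product of (b^2 + bc + c^2)(abc)^2 over T is a nonzero integer. A factor has modulus at most
  1/4 when a, b, c lie in the closed unit disc, and at most 3 \<alpha>^2 when one of them is \<alpha>;
  comparing these bounds gives 4^(d-3) \<le> (3 \<alpha>^2)^3 for the degree d, so d \<le> 8 because \<alpha> < 2.

  If e = 1, then \<alpha> is a sum of two conjugates in n ways and a difference of two conjugates in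
  n ways; these 3n + 1 numbers are distinct, so n = 2 and d \<ge> 7, and the vanishing trace
  forces \<alpha> \<le> 5/4, against the degree bound. If e = -1, then n is even and 3 divides dn, and
  the trace leaves n = 2 with d = 3 or d = 6. For d = 3 the minimal polynomial is
  x^3 - Px - q with integers 0 < q < 2 and 0 < P < 1 + q. For d = 6 it would be the product of two
  such cubics, and integrality of its coefficients is contradictory.
\<close>

text \<open>The trace argument works only when few conjugates lie outside those tied to alpha, so
  the degree must be bounded first. Only 3n of the dn triples contain alpha; it is enough to find an
  invariant that never vanishes and stays below a constant less than 1 on all other triples. Neither
  factor does this alone. For zero-sum triples in the closed disc, abc reaches modulus 1 at the cube
  roots of unity, where the quadratic form vanishes; the form reaches modulus 1 at (1, -1, 0), where
  abc vanishes. Their product stays away from both extremes. On zero-sum triples the form is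
  symmetric, and squaring abc removes the sign e, so neither the position of alpha nor the choice of
  relation matters for the estimates.\<close>

section \<open>Sums and products of algebraic integers\<close>

text \<open>The \<open>w i\<close> form an eigenvector of an integer matrix with eigenvalue
  \<open>z\<close>, and the characteristic polynomial of that matrix is monic with integer
  coefficients. The \<open>w i\<close> may be linearly dependent; a single nonzero entry makes the
  vector nonzero.\<close>

lemma algebraic_int_if_integral_matrix:
  fixes w :: "'i \<Rightarrow> complex" and z :: complex
  assumes "finite I" and "k \<in> I" "w k \<noteq> 0"
    and A: "\<And>i. i \<in> I \<Longrightarrow> \<exists>c :: 'i \<Rightarrow> int. z * w i = (\<Sum>j\<in>I. of_int (c j) * w j)"
  shows "algebraic_int z"
proof -
  obtain e where e: "bij_betw e {..<card I} I"
    using ex_bij_betw_nat_finite[OF \<open>finite I\<close>] by (auto simp: lessThan_atLeast0)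
  define n where "n = card I"
  from A obtain c :: "'i \<Rightarrow> 'i \<Rightarrow> int"
    where c: "\<And>i. i \<in> I \<Longrightarrow> z * w i = (\<Sum>j\<in>I. of_int (c i j) * w j)" by metis
  define B :: "int mat" where "B = mat n n (\<lambda>(i, j). c (e i) (e j))"
  define v :: "complex vec" where "v = vec n (\<lambda>i. w (e i))"
  have B: "B \<in> carrier_mat n n" by (simp add: B_def)
  have e_in: "i < n \<Longrightarrow> e i \<in> I" for i using e by (auto simp: bij_betw_def n_def)
  obtain k' where k': "k' < n" "e k' = k"
    using e \<open>k \<in> I\<close> unfolding bij_betw_def n_def by (metis imageE lessThan_iff)
  have row: "(\<Sum>j = 0..<n. of_int (c (e i) (e j)) * w (e j)) = z * w (e i)" if "i < n" for i
    using sum.reindex_bij_betw[OF e, of "\<lambda>j. of_int (c (e i) j) * w j"] c[OF e_in[OF that]]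
    by (simp add: n_def lessThan_atLeast0)
  have "eigenvector (map_mat of_int B) v z"
    unfolding eigenvector_def
  proof (intro conjI)
    show "v \<in> carrier_vec (dim_row (map_mat complex_of_int B))" using B by (simp add: v_def)
    show "v \<noteq> 0\<^sub>v (dim_row (map_mat complex_of_int B))"
    proof
      assume "v = 0\<^sub>v (dim_row (map_mat complex_of_int B))"
      hence "v $ k' = 0" using k' B by simp
      thus False using k' \<open>w k \<noteq> 0\<close> by (simp add: v_def)
    qed
    show "map_mat complex_of_int B *\<^sub>v v = z \<cdot>\<^sub>v v"
      by (intro eq_vecI) (simp_all add: B_def v_def scalar_prod_def row)
  qed
  hence "eigenvalue (map_mat of_int B) z" by (auto simp: eigenvalue_def)
  hence "poly (char_poly (map_mat of_int B)) z = 0"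
    using eigenvalue_root_char_poly[of "map_mat of_int B" n z] B by simp
  hence "poly (map_poly of_int (char_poly B)) z = 0"
    by (simp add: of_int_hom.char_poly_hom[OF B])
  moreover have "lead_coeff (char_poly B) = 1"
    using degree_monic_char_poly[OF B] by simp
  ultimately show ?thesis unfolding algebraic_int_altdef_ipoly by blast
qed

text \<open>The bound \<open>p > 0\<close> puts 1 among the monomials below the top degree; it will
  be the nonzero entry of the eigenvector.\<close>

lemma algebraic_int_power_relation:
  fixes x :: complex
  assumes "algebraic_int x"
  obtains p :: nat and c :: "nat \<Rightarrow> int"
  where "p > 0" "x ^ p = (\<Sum>l<p. of_int (c l) * x ^ l)"
proof -
  obtain f :: "int poly" where f: "poly (map_poly of_int f) x = 0" "lead_coeff f = 1"
    using assms algebraic_int_altdef_ipoly by blast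
  have "degree f \<noteq> 0"
  proof
    assume "degree f = 0"
    then obtain a where "f = [:a:]" using degree_eq_zeroE by blast
    thus False using f by simp
  qed
  have "0 = (\<Sum>l\<le>degree f. of_int (coeff f l) * x ^ l)"
    using f(1) by (simp add: poly_altdef degree_map_poly coeff_map_poly)
  also have "\<dots> = (\<Sum>l<degree f. of_int (coeff f l) * x ^ l) + x ^ degree f"
    using f(2) by (simp add: lessThan_Suc_atMost[symmetric])
  finally have "x ^ degree f = - (\<Sum>l<degree f. of_int (coeff f l) * x ^ l)"
    by (simp add: eq_neg_iff_add_eq_0 add.commute)
  also have "\<dots> = (\<Sum>l<degree f. of_int (- coeff f l) * x ^ l)"
    by (simp add: sum_negf)
  finally show ?thesis using that[of "degree f" "\<lambda>l. - coeff f l"] \<open>degree f \<noteq> 0\<close> by simp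
qed

lemma
  fixes x y :: complex
  assumes "algebraic_int x" "algebraic_int y"
  shows algebraic_int_add: "algebraic_int (x + y)"
    and algebraic_int_mult: "algebraic_int (x * y)"
proof -
  obtain p cx where p: "p > 0" "x ^ p = (\<Sum>l<p. of_int (cx l) * x ^ l)"
    using algebraic_int_power_relation[OF assms(1)] by blast
  obtain q cy where q: "q > 0" "y ^ q = (\<Sum>l<q. of_int (cy l) * y ^ l)"
    using algebraic_int_power_relation[OF assms(2)] by blast
  define I where "I = {..<p} \<times> {..<q}"
  define w where "w = (\<lambda>(i::nat, j::nat). x ^ i * y ^ j)"
  \<comment> \<open>\<open>M\<close> is the ring Z[x, y], written as the integer span of finitely
    many monomials. Its closure under multiplication by \<open>x\<close> and \<open>y\<close>
    supplies the integral matrices for sum and product alike.\<close>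
  define M where "M = {s. \<exists>c :: nat \<times> nat \<Rightarrow> int. s = (\<Sum>k\<in>I. of_int (c k) * w k)}"
  have fin: "finite I" by (simp add: I_def)
  have M_add: "a + b \<in> M" if ab: "a \<in> M" "b \<in> M" for a b
  proof -
    obtain c d :: "nat \<times> nat \<Rightarrow> int" where "a = (\<Sum>k\<in>I. of_int (c k) * w k)"
      "b = (\<Sum>k\<in>I. of_int (d k) * w k)" using ab by (auto simp: M_def)
    hence "a + b = (\<Sum>k\<in>I. of_int (c k + d k) * w k)"
      by (simp add: sum.distrib algebra_simps)
    thus ?thesis unfolding M_def mem_Collect_eq by (rule exI[of _ "\<lambda>k. c k + d k"])
  qed
  have M_scale: "of_int m * a \<in> M" if aM: "a \<in> M" for a m
  proof -
    obtain c :: "nat \<times> nat \<Rightarrow> int" where "a = (\<Sum>k\<in>I. of_int (c k) * w k)"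
      using aM by (auto simp: M_def)
    hence "of_int m * a = (\<Sum>k\<in>I. of_int (m * c k) * w k)"
      by (simp add: sum_distrib_left algebra_simps)
    thus ?thesis unfolding M_def mem_Collect_eq by (rule exI[of _ "\<lambda>k. m * c k"])
  qed
  have M0: "0 \<in> M" unfolding M_def by (auto intro!: exI[of _ "\<lambda>_. 0"])
  have M_sum: "(\<Sum>k\<in>J. of_int (c k) * g k) \<in> M" if "\<And>k. k \<in> J \<Longrightarrow> g k \<in> M"
    for J :: "'b set" and g c
    using that by (induction J rule: infinite_finite_induct) (auto intro: M0 M_add M_scale)
  have M_w: "w k \<in> M" if "k \<in> I" for k
  proof -
    have "w k = (\<Sum>j\<in>I. if j = k then w j else 0)" using that fin by simp
    also have "\<dots> = (\<Sum>j\<in>I. of_int (if j = k then 1 else 0) * w j)"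
      by (intro sum.cong) auto
    finally show ?thesis unfolding M_def mem_Collect_eq
      by (rule exI[of _ "\<lambda>j. if j = k then 1 else 0"])
  qed
  have xw: "x * w k \<in> M" if "k \<in> I" for k
  proof -
    obtain i j where k: "k = (i, j)" "i < p" "j < q" using \<open>k \<in> I\<close> by (auto simp: I_def)
    show ?thesis
    proof (cases "Suc i < p")
      case True
      thus ?thesis using M_w[of "(Suc i, j)"] k by (simp add: I_def w_def mult.assoc)
    next
      case False
      hence "Suc i = p" using k by simp
      hence "x * w k = x ^ p * y ^ j" using k by (auto simp: w_def)
      also have "\<dots> = (\<Sum>l<p. of_int (cx l) * w (l, j))"
        by (simp add: p(2) w_def sum_distrib_right mult.assoc)
      also have "\<dots> \<in> M" using k by (intro M_sum M_w) (auto simp: I_def)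
      finally show ?thesis .
    qed
  qed
  have yw: "y * w k \<in> M" if "k \<in> I" for k
  proof -
    obtain i j where k: "k = (i, j)" "i < p" "j < q" using \<open>k \<in> I\<close> by (auto simp: I_def)
    show ?thesis
    proof (cases "Suc j < q")
      case True
      thus ?thesis using M_w[of "(i, Suc j)"] k by (simp add: I_def w_def mult_ac)
    next
      case False
      hence "Suc j = q" using k by simp
      hence "y * w k = y ^ q * x ^ i" using k by (auto simp: w_def)
      also have "\<dots> = (\<Sum>l<q. of_int (cy l) * w (i, l))"
        by (simp add: q(2) w_def sum_distrib_right sum_distrib_left mult_ac)
      also have "\<dots> \<in> M" using k by (intro M_sum M_w) (auto simp: I_def)
      finally show ?thesis .
    qed
  qed
  have xM: "x * s \<in> M" if sM: "s \<in> M" for s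
  proof -
    obtain c :: "nat \<times> nat \<Rightarrow> int" where "s = (\<Sum>k\<in>I. of_int (c k) * w k)"
      using sM by (auto simp: M_def)
    hence "x * s = (\<Sum>k\<in>I. of_int (c k) * (x * w k))"
      by (simp add: sum_distrib_left mult_ac)
    thus ?thesis using M_sum[of I "\<lambda>k. x * w k" c] xw by simp
  qed
  have one: "(0, 0) \<in> I" "w (0, 0) \<noteq> 0" using p q by (auto simp: I_def w_def)
  show "algebraic_int (x + y)"
  proof (rule algebraic_int_if_integral_matrix[where w = w, OF fin one])
    fix i assume "i \<in> I"
    hence "(x + y) * w i \<in> M" unfolding distrib_right by (intro M_add xw yw)
    thus "\<exists>c :: nat \<times> nat \<Rightarrow> int. (x + y) * w i = (\<Sum>j\<in>I. of_int (c j) * w j)"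
      by (simp add: M_def)
  qed
  show "algebraic_int (x * y)"
  proof (rule algebraic_int_if_integral_matrix[where w = w, OF fin one])
    fix i assume "i \<in> I"
    hence "(x * y) * w i \<in> M" unfolding mult.assoc by (intro xM yw)
    thus "\<exists>c :: nat \<times> nat \<Rightarrow> int. (x * y) * w i = (\<Sum>j\<in>I. of_int (c j) * w j)"
      by (simp add: M_def)
  qed
qed

lemma algebraic_int_prod:
  fixes f :: "'b \<Rightarrow> complex"
  shows "(\<And>x. x \<in> A \<Longrightarrow> algebraic_int (f x)) \<Longrightarrow> algebraic_int (prod f A)"
  by (induction A rule: infinite_finite_induct)
    (auto intro: algebraic_int_mult int_imp_algebraic_int)

lemma algebraic_int_sum:
  fixes f :: "'b \<Rightarrow> complex"
  shows "(\<And>x. x \<in> A \<Longrightarrow> algebraic_int (f x)) \<Longrightarrow> algebraic_int (sum f A)"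
  by (induction A rule: infinite_finite_induct) (auto intro: algebraic_int_add)

section \<open>Embeddings of subfields of the complex numbers\<close>

text \<open>Such embeddings play the role of Galois automorphisms. The values of \<open>\<sigma>\<close> outside
  \<open>K\<close> are arbitrary.\<close>

locale subfield_embedding =
  fixes K :: "complex set" and \<sigma> :: "complex \<Rightarrow> complex"
  assumes one_mem: "1 \<in> K"
    and diff_mem: "x \<in> K \<Longrightarrow> y \<in> K \<Longrightarrow> x - y \<in> K"
    and mult_mem: "x \<in> K \<Longrightarrow> y \<in> K \<Longrightarrow> x * y \<in> K"
    and inverse_mem: "x \<in> K \<Longrightarrow> inverse x \<in> K"
    and map_one: "\<sigma> 1 = 1"
    and map_add: "x \<in> K \<Longrightarrow> y \<in> K \<Longrightarrow> \<sigma> (x + y) = \<sigma> x + \<sigma> y"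
    and map_mult: "x \<in> K \<Longrightarrow> y \<in> K \<Longrightarrow> \<sigma> (x * y) = \<sigma> x * \<sigma> y"
begin

lemma zero_mem: "0 \<in> K"
  using diff_mem[OF one_mem one_mem] by simp

lemma uminus_mem: "x \<in> K \<Longrightarrow> - x \<in> K"
  using diff_mem[OF zero_mem] by fastforce

lemma add_mem: "x \<in> K \<Longrightarrow> y \<in> K \<Longrightarrow> x + y \<in> K"
  using diff_mem[of x "- y"] uminus_mem by simp

lemma divide_mem: "x \<in> K \<Longrightarrow> y \<in> K \<Longrightarrow> x / y \<in> K"
  by (simp add: divide_inverse mult_mem inverse_mem)

lemma of_nat_mem: "of_nat n \<in> K"
  by (induction n) (auto intro: add_mem zero_mem one_mem)

lemma of_int_mem: "of_int n \<in> K"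
  by (cases n) (auto intro: of_nat_mem uminus_mem diff_mem one_mem)

lemma Rats_subset: "\<rat> \<subseteq> K"
  by (auto elim!: Rats_cases' intro: divide_mem of_int_mem)

lemma sum_mem: "(\<And>i. i \<in> A \<Longrightarrow> f i \<in> K) \<Longrightarrow> sum f A \<in> K"
  by (induction A rule: infinite_finite_induct) (auto intro: zero_mem add_mem)

lemma prod_mem: "(\<And>i. i \<in> A \<Longrightarrow> f i \<in> K) \<Longrightarrow> prod f A \<in> K"
  by (induction A rule: infinite_finite_induct) (auto intro: one_mem mult_mem)

lemma map_zero: "\<sigma> 0 = 0"
  using map_add[OF zero_mem zero_mem] by simp

lemma map_uminus: "x \<in> K \<Longrightarrow> \<sigma> (- x) = - \<sigma> x"
  using map_add[of x "- x"] uminus_mem[of x] map_zero by (simp add: eq_neg_iff_add_eq_0 add.commute)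

lemma map_diff: "x \<in> K \<Longrightarrow> y \<in> K \<Longrightarrow> \<sigma> (x - y) = \<sigma> x - \<sigma> y"
  using map_add[of x "- y"] uminus_mem[of y] map_uminus[of y] by simp

lemma map_sum: "(\<And>i. i \<in> A \<Longrightarrow> f i \<in> K) \<Longrightarrow> \<sigma> (sum f A) = (\<Sum>i\<in>A. \<sigma> (f i))"
  by (induction A rule: infinite_finite_induct) (auto simp: map_zero map_add sum_mem)

lemma map_prod: "(\<And>i. i \<in> A \<Longrightarrow> f i \<in> K) \<Longrightarrow> \<sigma> (prod f A) = (\<Prod>i\<in>A. \<sigma> (f i))"
  by (induction A rule: infinite_finite_induct) (auto simp: map_one map_mult prod_mem)

lemma map_power: "x \<in> K \<Longrightarrow> \<sigma> (x ^ n) = \<sigma> x ^ n"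
proof (induction n)
  case (Suc n)
  have "x ^ n \<in> K" using prod_mem[of "{..<n}" "\<lambda>_. x"] Suc.prems by simp
  thus ?case using Suc by (simp add: map_mult)
qed (simp add: map_one)

lemma power_mem: "x \<in> K \<Longrightarrow> x ^ n \<in> K"
  by (induction n) (auto intro: one_mem mult_mem)

lemma map_eq_0_iff: "x \<in> K \<Longrightarrow> \<sigma> x = 0 \<longleftrightarrow> x = 0"
  using map_mult[of x "inverse x"] inverse_mem[of x] map_one map_zero by (cases "x = 0") auto

lemma inj_on_K: "inj_on \<sigma> K"
  by (rule inj_onI) (metis map_diff map_eq_0_iff diff_mem right_minus_eq)

lemma map_of_nat: "\<sigma> (of_nat n) = of_nat n"
  by (induction n) (auto simp: map_zero map_one map_add of_nat_mem one_mem)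

lemma map_of_int: "\<sigma> (of_int n) = of_int n"
  by (cases n) (auto simp: map_of_nat map_diff map_uminus map_one one_mem of_nat_mem uminus_mem)

lemma map_Rats: "x \<in> \<rat> \<Longrightarrow> \<sigma> x = x"
proof (erule Rats_cases')
  fix a b :: int
  assume x: "x = of_int a / of_int b" "b > 0"
  have "\<sigma> x * \<sigma> (of_int b) = \<sigma> (x * of_int b)"
    using x by (intro map_mult[symmetric] divide_mem) (auto intro: of_int_mem divide_mem)
  also have "x * of_int b = of_int a" using x by simp
  finally have "\<sigma> x * of_int b = x * of_int b" using x by (simp add: map_of_int)
  thus ?thesis using x(2) by simp
qed

section \<open>Polynomials with coefficients in \<open>K\<close>\<close>

definition polys :: "complex poly set" where
  "polys = {p. \<forall>i. coeff p i \<in> K}"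

lemma coeff_mem: "p \<in> polys \<Longrightarrow> coeff p i \<in> K"
  by (simp add: polys_def)

lemma polys_add: "p \<in> polys \<Longrightarrow> q \<in> polys \<Longrightarrow> p + q \<in> polys"
  by (simp add: polys_def add_mem)

lemma polys_diff: "p \<in> polys \<Longrightarrow> q \<in> polys \<Longrightarrow> p - q \<in> polys"
  by (simp add: polys_def diff_mem)

lemma polys_mult: "p \<in> polys \<Longrightarrow> q \<in> polys \<Longrightarrow> p * q \<in> polys"
  by (simp add: polys_def coeff_mult sum_mem mult_mem)

lemma polys_monom: "c \<in> K \<Longrightarrow> monom c n \<in> polys"
  by (simp add: polys_def zero_mem)

lemma polys_const: "c \<in> K \<Longrightarrow> [:c:] \<in> polys"
  using polys_monom[of c 0] by (simp add: monom_0)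

lemma polys_0: "0 \<in> polys"
  by (simp add: polys_def zero_mem)

lemma polys_prod: "(\<And>i. i \<in> A \<Longrightarrow> f i \<in> polys) \<Longrightarrow> prod f A \<in> polys"
  by (induction A rule: infinite_finite_induct)
    (use polys_const[OF one_mem] in \<open>auto intro: polys_mult simp flip: one_pCons\<close>)

lemma polys_Rats: "(\<And>i. coeff p i \<in> \<rat>) \<Longrightarrow> p \<in> polys"
  using Rats_subset by (auto simp: polys_def)

text \<open>Long division; the point is that quotient and remainder keep their coefficients in the
  set \<open>K\<close>.\<close>

lemma polys_division:
  assumes "g \<in> polys" "g \<noteq> 0" "f \<in> polys"
  shows "\<exists>s\<in>polys. \<exists>r\<in>polys. f = g * s + r \<and> (r = 0 \<or> degree r < degree g)"
  using assms(3)
proof (induction "degree f" arbitrary: f rule: less_induct)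
  case less
  show ?case
  proof (cases "f = 0 \<or> degree f < degree g")
    case True
    thus ?thesis using less.prems polys_0 by (intro bexI[of _ 0] bexI[of _ f]) auto
  next
    case False
    define m where "m = monom (lead_coeff f / lead_coeff g) (degree f - degree g)"
    have m: "m \<in> polys"
      unfolding m_def using assms less.prems by (intro polys_monom divide_mem coeff_mem) auto
    have "m \<noteq> 0" using False assms(2) by (simp add: m_def)
    define f' where "f' = f - g * m"
    have f': "f' \<in> polys" unfolding f'_def using m assms less.prems by (intro polys_diff polys_mult)
    show ?thesis
    proof (cases "f' = 0")
      case True
      thus ?thesis using m polys_0 by (intro bexI[of _ m] bexI[of _ 0]) (auto simp: f'_def)
    next
      case nz: False
      have deg: "degree (g * m) = degree f"
        using False assms(2) \<open>m \<noteq> 0\<close> by (simp add: degree_mult_eq m_def degree_monom_eq)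
      have "lead_coeff (g * m) = lead_coeff f"
        using assms(2) False by (simp only: lead_coeff_mult m_def lead_coeff_monom) simp
      hence "coeff f' (degree f) = 0" using deg by (simp add: f'_def)
      moreover have "degree f' \<le> degree f"
        unfolding f'_def using deg by (intro degree_diff_le) auto
      ultimately have "degree f' < degree f"
        using nz by (metis le_neq_implies_less leading_coeff_0_iff)
      from less.hyps[OF this f'] obtain s r where sr: "s \<in> polys" "r \<in> polys"
        "f' = g * s + r" "r = 0 \<or> degree r < degree g" by blast
      have "f = g * (s + m) + r" using sr(3) by (simp add: f'_def algebra_simps)
      thus ?thesis using sr m polys_add by blast
    qed
  qed
qed

lemma map_poly_mult:
  assumes "p \<in> polys" "q \<in> polys"
  shows "map_poly \<sigma> (p * q) = map_poly \<sigma> p * map_poly \<sigma> q"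
proof (rule poly_eqI)
  fix n
  have "coeff (map_poly \<sigma> (p * q)) n = \<sigma> (\<Sum>i\<le>n. coeff p i * coeff q (n - i))"
    by (simp add: coeff_map_poly map_zero coeff_mult)
  also have "\<dots> = (\<Sum>i\<le>n. \<sigma> (coeff p i * coeff q (n - i)))"
    using assms by (intro map_sum mult_mem coeff_mem)
  also have "\<dots> = coeff (map_poly \<sigma> p * map_poly \<sigma> q) n"
    unfolding coeff_mult
    by (intro sum.cong refl) (simp add: map_mult coeff_mem assms coeff_map_poly map_zero)
  finally show "coeff (map_poly \<sigma> (p * q)) n = coeff (map_poly \<sigma> p * map_poly \<sigma> q) n" .
qed

lemma map_poly_add:
  assumes "p \<in> polys" "q \<in> polys"
  shows "map_poly \<sigma> (p + q) = map_poly \<sigma> p + map_poly \<sigma> q"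
  by (intro poly_eqI) (simp add: coeff_map_poly map_zero map_add coeff_mem assms)

lemma map_poly_diff:
  assumes "p \<in> polys" "q \<in> polys"
  shows "map_poly \<sigma> (p - q) = map_poly \<sigma> p - map_poly \<sigma> q"
  by (intro poly_eqI) (simp add: coeff_map_poly map_zero map_diff coeff_mem assms)

lemma map_poly_Rats: "(\<And>i. coeff p i \<in> \<rat>) \<Longrightarrow> map_poly \<sigma> p = p"
  by (intro poly_eqI) (simp add: coeff_map_poly map_zero map_Rats)

lemma map_poly_pCons: "map_poly \<sigma> (pCons a p) = pCons (\<sigma> a) (map_poly \<sigma> p)"
  by (intro poly_eqI) (simp add: coeff_map_poly map_zero coeff_pCons split: nat.split)

lemma degree_map_poly_eq: "p \<in> polys \<Longrightarrow> degree (map_poly \<sigma> p) = degree p"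
  by (cases "p = 0") (auto intro!: degree_map_poly simp: map_eq_0_iff coeff_mem)

lemma poly_map_poly_eq:
  assumes "p \<in> polys" "x \<in> K"
  shows "poly (map_poly \<sigma> p) (\<sigma> x) = \<sigma> (poly p x)"
proof -
  have "\<sigma> (poly p x) = (\<Sum>i\<le>degree p. \<sigma> (coeff p i * x ^ i))"
    unfolding poly_altdef using assms by (intro map_sum mult_mem coeff_mem power_mem)
  also have "\<dots> = (\<Sum>i\<le>degree p. \<sigma> (coeff p i) * \<sigma> x ^ i)"
    using assms by (intro sum.cong refl) (simp add: map_mult map_power coeff_mem power_mem)
  also have "\<dots> = poly (map_poly \<sigma> p) (\<sigma> x)"
    unfolding poly_altdef degree_map_poly_eq[OF assms(1)]
    by (simp add: coeff_map_poly map_zero)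
  finally show ?thesis ..
qed

section \<open>Minimal polynomials over \<open>K\<close> and extension of embeddings\<close>

definition is_min_poly :: "complex poly \<Rightarrow> complex \<Rightarrow> bool" where
  "is_min_poly u z \<longleftrightarrow> u \<in> polys \<and> u \<noteq> 0 \<and> poly u z = 0 \<and>
     (\<forall>p\<in>polys. p \<noteq> 0 \<longrightarrow> poly p z = 0 \<longrightarrow> degree u \<le> degree p)"

lemma is_min_poly_exists:
  assumes "p \<in> polys" "p \<noteq> 0" "poly p z = 0"
  obtains u where "is_min_poly u z"
proof -
  obtain u where "u \<in> polys \<and> u \<noteq> 0 \<and> poly u z = 0"
    "\<And>p. p \<in> polys \<and> p \<noteq> 0 \<and> poly p z = 0 \<Longrightarrow> degree u \<le> degree p"
    using ex_has_least_nat[of "\<lambda>p. p \<in> polys \<and> p \<noteq> 0 \<and> poly p z = 0" p degree] assms by blast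
  thus ?thesis using that unfolding is_min_poly_def by blast
qed

lemma is_min_poly_dvd:
  assumes "is_min_poly u z" "p \<in> polys" "poly p z = 0"
  obtains s where "s \<in> polys" "p = u * s"
proof -
  obtain s r where sr: "s \<in> polys" "r \<in> polys" "p = u * s + r" "r = 0 \<or> degree r < degree u"
    using polys_division[of u p] assms by (auto simp: is_min_poly_def)
  have "poly r z = 0" using sr(3) assms by (simp add: is_min_poly_def)
  hence "r = 0" using sr assms(1) unfolding is_min_poly_def by (meson not_le)
  thus ?thesis using sr that by simp
qed

lemma degree_min_poly_pos:
  assumes "is_min_poly u z"
  shows "degree u > 0"
proof (rule ccontr)
  assume "\<not> degree u > 0"
  then obtain a where "u = [:a:]" using degree_eq_zeroE by blast
  thus False using assms by (simp add: is_min_poly_def)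
qed

text \<open>Dividing u = p s + r gives r(z) = - p(z) s(z), so an inverse of r(z), available by
  induction on the degree, yields one of p(z). Minimality of \<open>u\<close> keeps p(z), s(z) and
  hence r(z) nonzero.\<close>

lemma adjoin_inverse:
  assumes u: "is_min_poly u z" and "p \<in> polys" "degree p < degree u" "p \<noteq> 0"
  shows "\<exists>q\<in>polys. poly q z * poly p z = 1"
  using assms(2-)
proof (induction "degree p" arbitrary: p rule: less_induct)
  case less
  have u': "u \<in> polys" "u \<noteq> 0" "poly u z = 0" using u by (auto simp: is_min_poly_def)
  show ?case
  proof (cases "degree p = 0")
    case True
    then obtain a where a: "p = [:a:]" using degree_eq_zeroE by blast
    have "a \<in> K" using coeff_mem[OF less.prems(1), of 0] a by simp
    hence "[:inverse a:] \<in> polys" by (intro polys_const inverse_mem)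
    thus ?thesis using a less.prems by (intro bexI[of _ "[:inverse a:]"]) auto
  next
    case False
    obtain s r where sr: "s \<in> polys" "r \<in> polys" "u = p * s + r" "r = 0 \<or> degree r < degree p"
      using polys_division[OF less.prems(1,3) u'(1)] by blast
    have "degree r < degree p" using sr(4) False by auto
    hence ru: "degree r < degree u" using less.prems by simp
    have "s \<noteq> 0" using sr(3) ru by auto
    hence "degree u = degree p + degree s"
      using sr(3) \<open>degree r < degree p\<close> less.prems
      by (simp add: degree_add_eq_left degree_mult_eq)
    hence "degree s < degree u" using False by simp
    hence "poly s z \<noteq> 0"
      using u sr(1) \<open>s \<noteq> 0\<close> unfolding is_min_poly_def by (meson not_le)
    have "poly p z \<noteq> 0"
      using u less.prems unfolding is_min_poly_def by (meson not_le)
    have rz: "poly r z = - (poly p z * poly s z)"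
      using u'(3) sr(3) by (simp add: eq_neg_iff_add_eq_0 add.commute)
    hence "r \<noteq> 0" using \<open>poly s z \<noteq> 0\<close> \<open>poly p z \<noteq> 0\<close> by auto
    from less.hyps[OF \<open>degree r < degree p\<close> sr(2) ru this]
    obtain q where q: "q \<in> polys" "poly q z * poly r z = 1" by blast
    have "0 - q * s \<in> polys" using q sr by (intro polys_diff polys_mult polys_0)
    moreover have "poly (0 - q * s) z * poly p z = 1"
      using q(2) rz by (simp add: algebra_simps)
    ultimately show ?thesis by blast
  qed
qed

text \<open>The larger field is K[z], closed under inverses by \<open>adjoin_inverse\<close>, and
  p(z) is sent to the transported p evaluated at z'. The choice of p does not matter, because two
  polynomials with the same value at z differ by a multiple of \<open>u\<close>.\<close>

lemma extend_to_root:
  assumes u: "is_min_poly u z" and z': "poly (map_poly \<sigma> u) z' = 0"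
  obtains K' \<sigma>' where "subfield_embedding K' \<sigma>'" "K \<subseteq> K'" "z \<in> K'"
    "\<And>x. x \<in> K \<Longrightarrow> \<sigma>' x = \<sigma> x" "\<sigma>' z = z'"
proof -
  have u': "u \<in> polys" "u \<noteq> 0" "poly u z = 0" using u by (auto simp: is_min_poly_def)
  define K' where "K' = (\<lambda>p. poly p z) ` polys"
  define \<sigma>' where
    "\<sigma>' = (\<lambda>w. poly (map_poly \<sigma> (SOME p. p \<in> polys \<and> poly p z = w)) z')"
  have \<sigma>': "\<sigma>' (poly p z) = poly (map_poly \<sigma> p) z'" if p: "p \<in> polys" for p
  proof -
    define q where "q = (SOME q. q \<in> polys \<and> poly q z = poly p z)"
    have q: "q \<in> polys" "poly q z = poly p z"
      using someI[of "\<lambda>q. q \<in> polys \<and> poly q z = poly p z" p] p by (auto simp: q_def)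
    obtain s where s: "s \<in> polys" "p - q = u * s"
      using is_min_poly_dvd[OF u, of "p - q"] p q polys_diff by auto
    have "map_poly \<sigma> p - map_poly \<sigma> q = map_poly \<sigma> u * map_poly \<sigma> s"
      using map_poly_diff[OF p q(1)] map_poly_mult[OF u'(1) s(1)] s(2) by simp
    hence "poly (map_poly \<sigma> p - map_poly \<sigma> q) z' = 0" using z' by simp
    thus ?thesis by (simp add: \<sigma>'_def q_def)
  qed
  have K'I: "poly p z \<in> K'" if "p \<in> polys" for p using that by (auto simp: K'_def)
  have K'E: "\<exists>p\<in>polys. w = poly p z" if "w \<in> K'" for w using that by (auto simp: K'_def)
  have const: "x \<in> K' \<and> \<sigma>' x = \<sigma> x" if "x \<in> K" for x
    using K'I[OF polys_const[OF that]] \<sigma>'[OF polys_const[OF that]]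
    by (simp add: map_poly_pCons)
  have zpoly: "[:0, 1:] \<in> polys"
    using polys_monom[OF one_mem, of 1] by (simp add: monom_altdef)
  have z: "z \<in> K'" "\<sigma>' z = z'"
    using K'I[OF zpoly] \<sigma>'[OF zpoly] by (simp_all add: map_poly_pCons map_zero map_one)
  have "subfield_embedding K' \<sigma>'"
  proof
    show "1 \<in> K'" "\<sigma>' 1 = 1" using const[OF one_mem] map_one by simp_all
  next
    fix x y assume "x \<in> K'" "y \<in> K'"
    then obtain p q where pq: "p \<in> polys" "x = poly p z" "q \<in> polys" "y = poly q z"
      using K'E by meson
    show "x - y \<in> K'" using K'I[OF polys_diff[OF pq(1,3)]] pq by simp
    show "x * y \<in> K'" using K'I[OF polys_mult[OF pq(1,3)]] pq by simp
    show "\<sigma>' (x + y) = \<sigma>' x + \<sigma>' y"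
      using \<sigma>'[OF polys_add[OF pq(1,3)]] \<sigma>'[OF pq(1)] \<sigma>'[OF pq(3)] pq(2,4)
      by (simp add: map_poly_add[OF pq(1,3)])
    show "\<sigma>' (x * y) = \<sigma>' x * \<sigma>' y"
      using \<sigma>'[OF polys_mult[OF pq(1,3)]] \<sigma>'[OF pq(1)] \<sigma>'[OF pq(3)] pq(2,4)
      by (simp add: map_poly_mult[OF pq(1,3)])
  next
    fix x assume "x \<in> K'"
    then obtain p where p: "p \<in> polys" "x = poly p z" using K'E by meson
    obtain s r where sr: "s \<in> polys" "r \<in> polys" "p = u * s + r" "r = 0 \<or> degree r < degree u"
      using polys_division[OF u'(1,2) p(1)] by blast
    have x: "x = poly r z" using p(2) sr(3) u'(3) by simp
    show "inverse x \<in> K'"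
    proof (cases "x = 0")
      case True
      thus ?thesis using const[OF zero_mem] by simp
    next
      case False
      hence "r \<noteq> 0" using x by auto
      then obtain q where "q \<in> polys" "poly q z * x = 1"
        using adjoin_inverse[OF u sr(2)] sr(4) x by auto
      thus ?thesis using K'I[of q] False by (metis inverse_unique mult.commute)
    qed
  qed
  thus ?thesis using that const z by blast
qed

text \<open>The elements are adjoined one at a time; each has a possible image because its
  transported minimal polynomial has a complex root.\<close>

lemma extend_to_algebraic:
  assumes "finite A" "\<And>z. z \<in> A \<Longrightarrow> algebraic z"
  shows "\<exists>K' \<sigma>'. subfield_embedding K' \<sigma>' \<and> K \<subseteq> K' \<and> A \<subseteq> K' \<and> (\<forall>x\<in>K. \<sigma>' x = \<sigma> x)"
  using assms
proof (induction A rule: finite_induct)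
  case empty
  show ?case using subfield_embedding_axioms by blast
next
  case (insert z A)
  then obtain L \<tau> where L: "subfield_embedding L \<tau>" "K \<subseteq> L" "A \<subseteq> L" "\<forall>x\<in>K. \<tau> x = \<sigma> x"
    by auto
  interpret L: subfield_embedding L \<tau> by fact
  obtain p where p: "\<forall>i. coeff p i \<in> \<rat>" "p \<noteq> 0" "poly p z = 0"
    using insert.prems by (auto simp: algebraic_altdef)
  obtain u where u: "L.is_min_poly u z"
    using L.is_min_poly_exists[OF L.polys_Rats] p by blast
  have "degree (map_poly \<tau> u) > 0"
    using L.degree_min_poly_pos[OF u] u by (simp add: L.degree_map_poly_eq L.is_min_poly_def)
  hence "\<not> constant (poly (map_poly \<tau> u))" by (simp add: constant_degree)
  then obtain z' where "poly (map_poly \<tau> u) z' = 0"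
    using fundamental_theorem_of_algebra by blast
  from L.extend_to_root[OF u this] obtain K' \<sigma>' where "subfield_embedding K' \<sigma>'" "L \<subseteq> K'" "z \<in> K'"
    "\<And>x. x \<in> L \<Longrightarrow> \<sigma>' x = \<tau> x" by metis
  thus ?case using L by (intro exI[of _ K'] exI[of _ \<sigma>']) auto
qed

end

section \<open>Conjugates\<close>

lemma subfield_embedding_Rats: "subfield_embedding \<rat> (\<lambda>x. x)"
  by unfold_locales auto

lemma map_poly_of_rat_surj:
  fixes p :: "'a :: field_char_0 poly"
  assumes "\<And>i. coeff p i \<in> \<rat>"
  obtains q where "p = map_poly of_rat q"
proof -
  have "\<exists>c. \<forall>i. coeff p i = of_rat (c i)"
    using assms by (intro choice) (auto elim: Rats_cases)
  then obtain c where c: "\<And>i. coeff p i = of_rat (c i)" by blast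
  have "coeff (Abs_poly c) = c"
  proof (rule Abs_poly_inverse, safe)
    have "c n = 0 \<longleftrightarrow> coeff p n = 0" for n by (simp add: c)
    thus "\<forall>\<^sub>\<infinity>n. c n = 0" using MOST_coeff_eq_0[of p] by simp
  qed
  hence "p = map_poly of_rat (Abs_poly c)"
    by (intro poly_eqI) (simp add: coeff_map_poly c)
  thus ?thesis by (rule that)
qed

context
  fixes \<alpha> :: complex and f :: "complex poly"
  assumes \<alpha>: "algebraic \<alpha>"
  defines "f \<equiv> map_poly of_rat (min_poly_over_Q \<alpha>)"
begin

interpretation Q: subfield_embedding \<rat> "\<lambda>x. x" by (rule subfield_embedding_Rats)

lemma min_poly_over_Q_props:
  "lead_coeff f = 1" "coeff f i \<in> \<rat>" "poly f \<alpha> = 0"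
  "\<And>p. p \<noteq> 0 \<Longrightarrow> (\<And>i. coeff p i \<in> \<rat>) \<Longrightarrow> poly p \<alpha> = 0 \<Longrightarrow> degree f \<le> degree p"
proof -
  note * = theI'[OF min_poly_over_Q_ex1[OF \<alpha>], folded min_poly_over_Q_def]
  have deg: "degree (map_poly of_rat q :: complex poly) = degree q" for q :: "rat poly"
    by (cases "q = 0") (auto intro!: degree_map_poly)
  show "lead_coeff f = 1" using * by (simp add: f_def deg coeff_map_poly)
  show "coeff f i \<in> \<rat>" by (simp add: f_def coeff_map_poly)
  show "poly f \<alpha> = 0" using * by (simp add: f_def)
  fix p :: "complex poly"
  assume p: "p \<noteq> 0" "\<And>i. coeff p i \<in> \<rat>" "poly p \<alpha> = 0"
  obtain q where "p = map_poly of_rat q" using map_poly_of_rat_surj[OF p(2)] by blast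
  thus "degree f \<le> degree p" using p * by (auto simp: f_def deg)
qed

lemma mem_conjugates_iff: "x \<in> conjugates_over_Q \<alpha> \<longleftrightarrow> poly f x = 0"
  by (simp add: conjugates_over_Q_def f_def)

text \<open>This is the irreducibility of f. If g is the minimal polynomial of x and f = g s, then
  alpha is a root of g or of s, and s has too small a degree.\<close>

lemma conjugate_is_min_poly:
  assumes "x \<in> conjugates_over_Q \<alpha>"
  shows "Q.is_min_poly f x"
proof -
  have fx: "poly f x = 0" using assms by (simp add: conjugates_over_Q_def f_def)
  have f: "f \<in> Q.polys" "f \<noteq> 0"
    using min_poly_over_Q_props(1,2) by (auto simp: Q.polys_def)
  obtain g where g: "Q.is_min_poly g x" using Q.is_min_poly_exists f fx by blast
  obtain s where s: "s \<in> Q.polys" "f = g * s" using Q.is_min_poly_dvd[OF g f(1) fx] by blast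
  have "g \<noteq> 0" "s \<noteq> 0" using s f by auto
  hence deg: "degree f = degree g + degree s" using s by (simp add: degree_mult_eq)
  have "poly g \<alpha> = 0 \<or> poly s \<alpha> = 0" using min_poly_over_Q_props(3) s by simp
  hence "degree f \<le> degree g"
  proof
    assume "poly g \<alpha> = 0"
    thus ?thesis using g \<open>g \<noteq> 0\<close>
      by (intro min_poly_over_Q_props(4)) (auto simp: Q.is_min_poly_def Q.polys_def)
  next
    assume "poly s \<alpha> = 0"
    hence "degree f \<le> degree s" using s(1) \<open>s \<noteq> 0\<close>
      by (intro min_poly_over_Q_props(4)) (auto simp: Q.polys_def)
    thus ?thesis using deg Q.degree_min_poly_pos[OF g] by simp
  qed
  thus ?thesis using g f fx unfolding Q.is_min_poly_def by (meson le_trans)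
qed

lemma conjugates_transitive:
  assumes x: "x \<in> conjugates_over_Q \<alpha>" and y: "y \<in> conjugates_over_Q \<alpha>"
    and A: "finite A" "\<And>z. z \<in> A \<Longrightarrow> algebraic z"
  obtains K \<sigma> where "subfield_embedding K \<sigma>" "x \<in> K" "A \<subseteq> K" "\<sigma> x = y"
proof -
  have "poly (map_poly (\<lambda>x. x) f) y = 0"
    using y by (simp add: conjugates_over_Q_def f_def map_poly_id')
  from Q.extend_to_root[OF conjugate_is_min_poly[OF x] this]
  obtain L \<tau> where L: "subfield_embedding L \<tau>" "x \<in> L" "\<tau> x = y" by metis
  interpret L: subfield_embedding L \<tau> by fact
  obtain K \<sigma> where "subfield_embedding K \<sigma>" "L \<subseteq> K" "A \<subseteq> K" "\<forall>x\<in>L. \<sigma> x = \<tau> x"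
    using L.extend_to_algebraic[OF A] by blast
  thus ?thesis using L that[of K \<sigma>] by auto
qed

lemma finite_conjugates: "finite (conjugates_over_Q \<alpha>)"
proof -
  have "f \<noteq> 0" using min_poly_over_Q_props(1) by auto
  thus ?thesis using poly_roots_finite[of f] by (simp flip: mem_conjugates_iff)
qed

lemma self_mem_conjugates: "\<alpha> \<in> conjugates_over_Q \<alpha>"
  using min_poly_over_Q_props(3) by (simp add: mem_conjugates_iff)

lemma cnj_mem_conjugates:
  assumes "x \<in> conjugates_over_Q \<alpha>"
  shows "cnj x \<in> conjugates_over_Q \<alpha>"
proof -
  have "poly (map_poly cnj f) (cnj x) = cnj (poly f x)" by (rule poly_cnj[symmetric])
  moreover have "map_poly cnj f = f"
  proof (rule poly_eqI)
    fix i
    obtain a b where "coeff f i = of_int a / of_int b"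
      using min_poly_over_Q_props(2) by (metis Rats_cases')
    thus "coeff (map_poly cnj f) i = coeff f i" by (simp add: coeff_map_poly)
  qed
  ultimately show ?thesis using assms by (simp add: mem_conjugates_iff)
qed

lemma embedding_maps_conjugates:
  assumes "subfield_embedding K \<sigma>" "x \<in> K" "x \<in> conjugates_over_Q \<alpha>"
  shows "\<sigma> x \<in> conjugates_over_Q \<alpha>"
proof -
  interpret L: subfield_embedding K \<sigma> by fact
  have "poly (map_poly \<sigma> f) (\<sigma> x) = \<sigma> (poly f x)"
    using assms(2) min_poly_over_Q_props(2) by (intro L.poly_map_poly_eq L.polys_Rats)
  thus ?thesis using assms(3) min_poly_over_Q_props(2)
    by (simp add: mem_conjugates_iff L.map_poly_Rats L.map_zero)
qed

text \<open>An embedding taking alpha to x fixes integer polynomials, so a monic one vanishing at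
  alpha also vanishes at x.\<close>

lemma conjugates_algebraic_int:
  assumes "algebraic_int \<alpha>" "x \<in> conjugates_over_Q \<alpha>"
  shows "algebraic_int x"
proof -
  obtain h :: "int poly" where h: "poly (map_poly of_int h) \<alpha> = 0" "lead_coeff h = 1"
    using assms(1) algebraic_int_altdef_ipoly by blast
  obtain K \<sigma> where K: "subfield_embedding K \<sigma>" "\<alpha> \<in> K" "\<sigma> \<alpha> = x"
    using conjugates_transitive[OF self_mem_conjugates assms(2), of "{}"] by auto
  interpret L: subfield_embedding K \<sigma> by fact
  have "poly (map_poly \<sigma> (map_poly of_int h)) (\<sigma> \<alpha>) = \<sigma> (poly (map_poly of_int h) \<alpha>)"
    using K by (intro L.poly_map_poly_eq L.polys_Rats) (auto simp: coeff_map_poly)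
  hence "poly (map_poly of_int h) x = 0"
    using h K by (simp add: L.map_poly_Rats coeff_map_poly L.map_zero)
  thus ?thesis using h algebraic_int_altdef_ipoly by blast
qed

text \<open>The derivative of f has lower degree, hence does not vanish at alpha, so alpha is a
  simple root. Any cofactor of positive degree would have a root that is another conjugate;
  therefore f is linear.\<close>

lemma rational_if_no_other_conjugate:
  assumes "conjugates_over_Q \<alpha> \<subseteq> {\<alpha>}"
  shows "\<alpha> \<in> \<rat>"
proof -
  have fz: "f \<noteq> 0" using min_poly_over_Q_props(1) by auto
  have deg: "degree f > 0"
    using Q.degree_min_poly_pos[OF conjugate_is_min_poly[OF self_mem_conjugates]] .
  have pd: "poly (pderiv f) \<alpha> \<noteq> 0"
  proof
    assume "poly (pderiv f) \<alpha> = 0"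
    moreover have "pderiv f \<noteq> 0" using deg by (simp add: pderiv_eq_0_iff)
    moreover have "coeff (pderiv f) i \<in> \<rat>" for i
      using min_poly_over_Q_props(2) by (simp add: coeff_pderiv)
    ultimately have "degree f \<le> degree (pderiv f)" by (intro min_poly_over_Q_props(4))
    thus False using deg by (simp add: degree_pderiv)
  qed
  obtain g where g: "f = [:-\<alpha>, 1:] * g"
    using min_poly_over_Q_props(3) by (auto simp: poly_eq_0_iff_dvd elim: dvdE)
  have "poly g \<alpha> \<noteq> 0" using pd unfolding g pderiv_mult by (auto simp: pderiv_pCons)
  have "degree g = 0"
  proof (rule ccontr)
    assume "degree g \<noteq> 0"
    then obtain w where w: "poly g w = 0"
      using fundamental_theorem_of_algebra[of g] by (auto simp: constant_degree)
    hence "w \<in> conjugates_over_Q \<alpha>" by (simp add: mem_conjugates_iff) (simp add: g)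
    thus False using w \<open>poly g \<alpha> \<noteq> 0\<close> assms by auto
  qed
  then obtain c where c: "g = [:c:]" using degree_eq_zeroE by blast
  hence "c \<noteq> 0" using fz g by auto
  hence "c = 1" using min_poly_over_Q_props(1) unfolding g c by simp
  hence "coeff f 0 = - \<alpha>" by (simp add: g c)
  thus ?thesis using min_poly_over_Q_props(2)[of 0] by (metis Rats_minus_iff)
qed

end

text \<open>Every conjugate of V is the image of V under an embedding defined on A, hence V itself.
  So V is rational, and a rational algebraic integer is an integer.\<close>

lemma integral_if_fixed:
  assumes "algebraic_int V" "finite A" "\<And>z. z \<in> A \<Longrightarrow> algebraic z"
    and fixed: "\<And>K \<sigma>. subfield_embedding K \<sigma> \<Longrightarrow> V \<in> K \<Longrightarrow> A \<subseteq> K \<Longrightarrow> \<sigma> V = V"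
  shows "V \<in> \<int>"
proof -
  have alg: "algebraic V" using assms(1) by blast
  have "y = V" if "y \<in> conjugates_over_Q V" for y
    by (rule conjugates_transitive[OF alg self_mem_conjugates[OF alg] that assms(2,3)])
      (use fixed in auto)
  hence "V \<in> \<rat>" by (intro rational_if_no_other_conjugate[OF alg]) auto
  thus ?thesis using rational_algebraic_int_is_int assms(1) by blast
qed

section \<open>Three complex numbers with sum zero\<close>

text \<open>With s and t the squared moduli of b and c, the squares of the two sides differ by (1 -
  s)(1 - t)(s + t + s t).\<close>

lemma norm_one_minus_prod_le:
  fixes b c :: complex
  assumes "b + c = 1" "norm b \<le> 1" "norm c \<le> 1"
  shows "norm (1 - b * c) \<le> 1 - (norm (b * c))\<^sup>2"
proof -
  obtain p q where b: "b = Complex p q" by (cases b)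
  hence c: "c = Complex (1 - p) (- q)" using assms(1) by (simp add: complex_eq_iff)
  define s t where "s = p\<^sup>2 + q\<^sup>2" and "t = (1 - p)\<^sup>2 + q\<^sup>2"
  have nb: "(norm b)\<^sup>2 = s" "(norm c)\<^sup>2 = t"
    by (simp_all add: b c cmod_power2 s_def t_def)
  hence st: "s \<le> 1" "t \<le> 1" using assms power_le_one[of "norm b" 2] power_le_one[of "norm c" 2] by auto
  have nn: "s \<ge> 0" "t \<ge> 0" by (auto simp: s_def t_def)
  have "Re (1 - b * c) = 1 - p * (1 - p) - q\<^sup>2" "Im (1 - b * c) = p * q - q * (1 - p)"
    by (simp_all add: b c power2_eq_square)
  hence "(norm (1 - b * c))\<^sup>2 = (1 - p * (1 - p) - q\<^sup>2)\<^sup>2 + (p * q - q * (1 - p))\<^sup>2"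
    by (simp only: cmod_power2)
  hence "(1 - s * t)\<^sup>2 - (norm (1 - b * c))\<^sup>2 = (1 - s) * (1 - t) * (s + t + s * t)"
    unfolding s_def t_def by (simp add: algebra_simps power2_eq_square)
  also have "\<dots> \<ge> 0" using st nn by (intro mult_nonneg_nonneg) auto
  finally have "(norm (1 - b * c))\<^sup>2 \<le> (1 - s * t)\<^sup>2" by simp
  moreover have "1 - s * t \<ge> 0" using st nn by (simp add: mult_le_one)
  ultimately have "norm (1 - b * c) \<le> 1 - s * t" by (rule power2_le_imp_le)
  thus ?thesis by (simp add: norm_mult power_mult_distrib nb)
qed

text \<open>Dividing by the entry of largest modulus reduces to b + c = 1 with b and c in the disc,
  where the form becomes 1 - b c.\<close>

lemma sum_zero_max:
  fixes x y z :: complex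
  assumes "x + y + z = 0" "norm y \<le> norm x" "norm z \<le> norm x"
  shows "norm (y\<^sup>2 + y * z + z\<^sup>2) \<le> (norm x)\<^sup>2"
    and "norm x \<le> 1 \<Longrightarrow> norm ((y\<^sup>2 + y * z + z\<^sup>2) * (x * y * z)\<^sup>2) \<le> 1 / 4"
proof -
  have "norm (y\<^sup>2 + y * z + z\<^sup>2) \<le> (norm x)\<^sup>2 \<and>
    (norm x \<le> 1 \<longrightarrow> norm ((y\<^sup>2 + y * z + z\<^sup>2) * (x * y * z)\<^sup>2) \<le> 1 / 4)"
  proof (cases "x = 0")
    case False
    define b c where "b = - y / x" and "c = - z / x"
    have yz: "y = - (b * x)" "z = - (c * x)" using False by (auto simp: b_def c_def)
    have "x * (b + c) = x * 1" using assms(1) unfolding yz by (simp add: algebra_simps)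
    hence bc: "b + c = 1" using False by simp
    have "norm b \<le> 1" "norm c \<le> 1" using assms False by (auto simp: b_def c_def norm_divide)
    from norm_one_minus_prod_le[OF bc this]
    have le: "norm (1 - b * c) \<le> 1 - (norm (b * c))\<^sup>2" .
    have c: "c = 1 - b" using bc by (simp add: algebra_simps)
    have P: "y\<^sup>2 + y * z + z\<^sup>2 = x\<^sup>2 * (1 - b * c)"
      unfolding yz c by (simp add: algebra_simps power2_eq_square)
    have "norm (1 - b * c) \<le> 1" using le zero_le_power2[of "norm (b * c)"] by linarith
    hence 1: "norm (y\<^sup>2 + y * z + z\<^sup>2) \<le> (norm x)\<^sup>2"
      unfolding P norm_mult norm_power by (simp add: mult_left_le)
    have H: "(y\<^sup>2 + y * z + z\<^sup>2) * (x * y * z)\<^sup>2 = x ^ 8 * ((1 - b * c) * (b * c)\<^sup>2)"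
      unfolding P unfolding yz by (simp add: power_mult_distrib algebra_simps eval_nat_numeral)
    \<comment> \<open>The bound is (1 - u) u with u the squared modulus of b c; its maximum is 1/4,
      at u = 1/2.\<close>
    have "norm ((1 - b * c) * (b * c)\<^sup>2) \<le> (1 - (norm (b * c))\<^sup>2) * (norm (b * c))\<^sup>2"
      unfolding norm_mult[of "1 - b * c"] norm_power using le by (intro mult_right_mono) auto
    also have "\<dots> = 1 / 4 - ((norm (b * c))\<^sup>2 - 1 / 2)\<^sup>2"
      by (simp add: power2_eq_square algebra_simps)
    also have "\<dots> \<le> 1 / 4" by simp
    finally have "norm ((1 - b * c) * (b * c)\<^sup>2) \<le> 1 / 4" .
    hence "norm (x ^ 8 * ((1 - b * c) * (b * c)\<^sup>2)) \<le> 1 * (1 / 4)" if "norm x \<le> 1"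
      unfolding norm_mult[of "x ^ 8"] norm_power
      using that by (intro mult_mono) (auto intro: power_le_one)
    thus ?thesis using 1 unfolding H by simp
  qed (use assms in auto)
  thus "norm (y\<^sup>2 + y * z + z\<^sup>2) \<le> (norm x)\<^sup>2"
    and "norm x \<le> 1 \<Longrightarrow> norm ((y\<^sup>2 + y * z + z\<^sup>2) * (x * y * z)\<^sup>2) \<le> 1 / 4" by auto
qed

text \<open>On the plane x + y + z = 0 the form equals -(x y + y z + z x), so any of the three
  entries may be placed first.\<close>

lemma sum_zero_quadratic_form:
  fixes x y z :: complex
  assumes "x + y + z = 0"
  shows "x\<^sup>2 + x * z + z\<^sup>2 = y\<^sup>2 + y * z + z\<^sup>2" "x\<^sup>2 + x * y + y\<^sup>2 = y\<^sup>2 + y * z + z\<^sup>2"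
proof -
  have x: "x = - y - z" using assms by (simp add: algebra_simps eq_neg_iff_add_eq_0)
  show "x\<^sup>2 + x * z + z\<^sup>2 = y\<^sup>2 + y * z + z\<^sup>2" "x\<^sup>2 + x * y + y\<^sup>2 = y\<^sup>2 + y * z + z\<^sup>2"
    unfolding x by (simp_all add: algebra_simps power2_eq_square)
qed

lemma sum_zero_cases:
  fixes x y z :: complex
  assumes "x + y + z = 0"
  obtains u v w where "u + v + w = 0" "norm v \<le> norm u" "norm w \<le> norm u" "u \<in> {x, y, z}"
    "v\<^sup>2 + v * w + w\<^sup>2 = y\<^sup>2 + y * z + z\<^sup>2" "u * v * w = x * y * z"
proof -
  consider "norm y \<le> norm x" "norm z \<le> norm x" | "norm x \<le> norm y" "norm z \<le> norm y"
    | "norm x \<le> norm z" "norm y \<le> norm z" by linarith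
  thus ?thesis
  proof cases
    case 1
    thus ?thesis using assms by (intro that[of x y z]) auto
  next
    case 2
    thus ?thesis using assms sum_zero_quadratic_form[OF assms]
      by (intro that[of y x z]) (auto simp: algebra_simps)
  next
    case 3
    thus ?thesis using assms sum_zero_quadratic_form[OF assms]
      by (intro that[of z x y]) (auto simp: algebra_simps)
  qed
qed

lemma sum_zero_disc_bound:
  fixes x y z :: complex
  assumes "x + y + z = 0" "norm x \<le> 1" "norm y \<le> 1" "norm z \<le> 1"
  shows "norm ((y\<^sup>2 + y * z + z\<^sup>2) * (x * y * z)\<^sup>2) \<le> 1 / 4"
proof -
  obtain u v w where "u + v + w = 0" "norm v \<le> norm u" "norm w \<le> norm u" "u \<in> {x, y, z}"
    "v\<^sup>2 + v * w + w\<^sup>2 = y\<^sup>2 + y * z + z\<^sup>2" "u * v * w = x * y * z"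
    using sum_zero_cases[OF assms(1)] by metis
  moreover from this have "norm u \<le> 1" using assms by auto
  ultimately show ?thesis using sum_zero_max(2)[of u v w] by simp
qed

lemma sum_zero_open_disc_quadratic_form:
  fixes x y z :: complex
  assumes "x + y + z = 0" "norm x < 1" "norm y < 1" "norm z < 1"
  shows "norm (y\<^sup>2 + y * z + z\<^sup>2) < 1"
proof -
  obtain u v w where *: "u + v + w = 0" "norm v \<le> norm u" "norm w \<le> norm u" "u \<in> {x, y, z}"
    "v\<^sup>2 + v * w + w\<^sup>2 = y\<^sup>2 + y * z + z\<^sup>2" "u * v * w = x * y * z"
    using sum_zero_cases[OF assms(1)] by metis
  hence "norm u < 1" using assms by auto
  hence "(norm u)\<^sup>2 < 1" by (simp add: power_less_one_iff)
  thus ?thesis using sum_zero_max(1)[OF *(1-3)] *(5) by simp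
qed

text \<open>For triples with alpha in the position of x: the form then involves only the two small
  entries, and alpha enters through the squared product alone.\<close>

lemma sum_zero_one_large_bound:
  fixes x y z :: complex
  assumes "x + y + z = 0" "norm y \<le> 1" "norm z \<le> 1"
  shows "norm ((y\<^sup>2 + y * z + z\<^sup>2) * (x * y * z)\<^sup>2) \<le> 3 * (norm x)\<^sup>2"
proof -
  have "norm (y\<^sup>2 + y * z + z\<^sup>2) \<le> norm (y\<^sup>2) + norm (y * z) + norm (z\<^sup>2)"
    by (intro norm_triangle_le add_mono order_refl)
  also have "\<dots> \<le> 1 + 1 + 1"
    using assms by (intro add_mono) (auto simp: norm_mult norm_power power_le_one mult_le_one)
  finally have "norm (y\<^sup>2 + y * z + z\<^sup>2) \<le> 3" by simp
  moreover have "norm (x * y * z) \<le> norm x"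
    using assms by (simp add: norm_mult mult_left_le mult.assoc mult_le_one)
  hence "(norm (x * y * z))\<^sup>2 \<le> (norm x)\<^sup>2" by (intro power_mono) auto
  ultimately show ?thesis unfolding norm_mult[of _ "_\<^sup>2"] norm_power[of "x * y * z"]
    by (intro mult_mono) auto
qed

text \<open>Applied with k = 2 to the exchange of b and c, and with k = 3 to the cyclic rotation of
  triples.\<close>

lemma dvd_card_if_orbits:
  assumes "finite A" and "\<And>x. x \<in> A \<Longrightarrow> orb x \<subseteq> A" and "\<And>x. x \<in> A \<Longrightarrow> x \<in> orb x"
    and "\<And>x. x \<in> A \<Longrightarrow> card (orb x) = k"
    and "\<And>x y. x \<in> A \<Longrightarrow> y \<in> orb x \<Longrightarrow> orb y = orb x"
  shows "k dvd card A"
proof -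
  have A: "A = \<Union> (orb ` A)" using assms(2,3) by auto
  have "k dvd card (\<Union> (orb ` A))"
  proof (rule dvd_partition)
    show "finite (\<Union> (orb ` A))" using A assms(1) by simp
    show "\<forall>c\<in>orb ` A. k dvd card c" using assms(4) by auto
    show "\<forall>c1\<in>orb ` A. \<forall>c2\<in>orb ` A. c1 \<noteq> c2 \<longrightarrow> c1 \<inter> c2 = {}"
      using assms(5) by (metis (no_types, lifting) disjoint_iff imageE)
  qed
  thus ?thesis using A by simp
qed

section \<open>Pisot numbers\<close>

locale pisot =
  fixes \<alpha> :: real and R :: "complex set"
  assumes pisot: "Pisot_number \<alpha>"
  defines "R \<equiv> conjugates_over_Q (of_real \<alpha>)"
begin

lemma alpha_gt_1: "\<alpha> > 1"
  using pisot by (simp add: Pisot_number_def)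

lemma algebraic_int_alpha: "algebraic_int (complex_of_real \<alpha>)"
  using pisot by (simp add: Pisot_number_def)

lemma algebraic_alpha: "algebraic (complex_of_real \<alpha>)"
  using algebraic_int_alpha by blast

lemma finite_R: "finite R"
  unfolding R_def by (rule finite_conjugates[OF algebraic_alpha])

lemma alpha_mem: "of_real \<alpha> \<in> R"
  unfolding R_def by (rule self_mem_conjugates[OF algebraic_alpha])

lemma norm_less_1: "z \<in> R \<Longrightarrow> z \<noteq> of_real \<alpha> \<Longrightarrow> norm z < 1"
  using pisot by (auto simp: Pisot_number_def R_def)

lemma norm_le_alpha: "z \<in> R \<Longrightarrow> norm z \<le> \<alpha>"
  using norm_less_1[of z] alpha_gt_1 by (cases "z = of_real \<alpha>") auto

lemma norm_ge_1_imp: "z \<in> R \<Longrightarrow> norm z \<ge> 1 \<Longrightarrow> z = of_real \<alpha>"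
  using norm_less_1[of z] by fastforce

lemma algebraic_int_R: "x \<in> R \<Longrightarrow> algebraic_int x"
  unfolding R_def by (rule conjugates_algebraic_int[OF algebraic_alpha algebraic_int_alpha])

lemma algebraic_R: "x \<in> R \<Longrightarrow> algebraic x"
  using algebraic_int_R by blast

lemma cnj_mem: "x \<in> R \<Longrightarrow> cnj x \<in> R"
  unfolding R_def by (rule cnj_mem_conjugates[OF algebraic_alpha])

lemma transitive:
  assumes "x \<in> R" "y \<in> R"
  obtains K \<sigma> where "subfield_embedding K \<sigma>" "R \<subseteq> K" "\<sigma> x = y"
  using conjugates_transitive[OF algebraic_alpha, of x y R] assms finite_R algebraic_R
  unfolding R_def by metis

lemma embedding_mem:
  "subfield_embedding K \<sigma> \<Longrightarrow> R \<subseteq> K \<Longrightarrow> x \<in> R \<Longrightarrow> \<sigma> x \<in> R"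
  using embedding_maps_conjugates[OF algebraic_alpha] unfolding R_def by blast

text \<open>An embedding may move \<open>K\<close> elsewhere, but it maps the finite set
  \<open>R\<close> injectively into itself.\<close>

lemma embedding_bij_betw:
  assumes "subfield_embedding K \<sigma>" "R \<subseteq> K"
  shows "bij_betw \<sigma> R R"
proof -
  interpret L: subfield_embedding K \<sigma> by fact
  have "inj_on \<sigma> R" using L.inj_on_K assms(2) by (rule inj_on_subset)
  moreover have "\<sigma> ` R \<subseteq> R" using embedding_mem[OF assms] by auto
  ultimately show ?thesis using finite_R by (simp add: bij_betw_def endo_inj_surj)
qed

lemma integral_if_embedding_fixed:
  assumes "algebraic_int V"
    and "\<And>K \<sigma>. subfield_embedding K \<sigma> \<Longrightarrow> R \<subseteq> K \<Longrightarrow> \<sigma> V = V"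
  shows "V \<in> \<int>"
  using assms finite_R algebraic_R by (intro integral_if_fixed[of V R]) auto

text \<open>An embedding moving x to alpha would make - alpha a conjugate of modulus above 1 other
  than alpha.\<close>

lemma uminus_not_mem:
  assumes "x \<in> R" shows "- x \<notin> R"
proof
  assume y: "- x \<in> R"
  obtain K \<sigma> where K: "subfield_embedding K \<sigma>" "R \<subseteq> K" "\<sigma> x = of_real \<alpha>"
    using transitive[OF assms alpha_mem] by metis
  interpret L: subfield_embedding K \<sigma> by fact
  have "x \<in> K" using K(2) assms by blast
  hence "- complex_of_real \<alpha> \<in> R"
    using L.map_uminus[of x] embedding_mem[OF K(1,2) y] by (simp only: K(3))
  hence "- complex_of_real \<alpha> = of_real \<alpha>"
    using norm_ge_1_imp[of "- complex_of_real \<alpha>"] alpha_gt_1 by simp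
  thus False using alpha_gt_1 by (simp add: complex_eq_iff)
qed

lemma zero_not_mem: "0 \<notin> R"
proof
  assume "0 \<in> R"
  from uminus_not_mem[OF this] this show False by simp
qed

text \<open>Moving x to alpha would produce a conjugate of modulus 2 alpha. This rules out
  coincidences inside a triple in which one entry becomes plus or minus twice another.\<close>

lemma double_not_mem:
  assumes "x \<in> R" "norm c = 1" "c \<in> \<rat>" shows "c * (2 * x) \<notin> R"
proof
  assume y: "c * (2 * x) \<in> R"
  obtain K \<sigma> where K: "subfield_embedding K \<sigma>" "R \<subseteq> K" "\<sigma> x = of_real \<alpha>"
    using transitive[OF assms(1) alpha_mem] by metis
  interpret L: subfield_embedding K \<sigma> by fact
  have xK: "x \<in> K" using K assms by auto
  have "c \<in> K" using L.Rats_subset assms by auto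
  hence "\<sigma> (c * (2 * x)) = \<sigma> c * (\<sigma> 2 * \<sigma> x)"
    using xK L.Rats_subset by (simp add: L.map_mult L.mult_mem subset_iff)
  also have "\<dots> = c * (2 * of_real \<alpha>)" using assms K L.map_Rats by auto
  finally have "norm (\<sigma> (c * (2 * x))) = 2 * \<alpha>" using assms alpha_gt_1 by (simp add: norm_mult)
  moreover have "\<sigma> (c * (2 * x)) \<in> R" using embedding_mem[OF K(1,2) y] .
  ultimately show False using norm_le_alpha[of "\<sigma> (c * (2 * x))"] alpha_gt_1 by linarith
qed

text \<open>The coefficients are algebraic integers, and an embedding only permutes the linear
  factors. They carry the arithmetic of the degree 3 and degree 6 cases.\<close>

lemma prod_linear_coeff_Ints: "coeff (\<Prod>r\<in>R. [:- r, 1:]) i \<in> \<int>"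
proof (rule integral_if_embedding_fixed)
  define g where "g = (\<Prod>r\<in>R. [:- r, 1:])"
  have "\<forall>i. algebraic_int (coeff (\<Prod>r\<in>S. [:- r, 1:]) i)" if "finite S" "S \<subseteq> R" for S
    using that
  proof (induction S rule: finite_induct)
    case (insert x S)
    have lin: "algebraic_int (coeff [:- x, 1:] j)" for j
      using insert.prems algebraic_int_R
      by (auto simp: coeff_pCons int_imp_algebraic_int split: nat.split)
    show ?case using insert lin
      by (auto simp del: mult_pCons_left simp: coeff_mult intro!: algebraic_int_sum algebraic_int_mult)
  qed (simp add: int_imp_algebraic_int)
  thus "algebraic_int (coeff (\<Prod>r\<in>R. [:- r, 1:]) i)" using finite_R by blast
  fix K \<sigma> assume K: "subfield_embedding K \<sigma>" "R \<subseteq> K"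
  interpret L: subfield_embedding K \<sigma> by fact
  have lin: "[:- r, 1:] \<in> L.polys \<and> map_poly \<sigma> [:- r, 1:] = [:- \<sigma> r, 1:]" if "r \<in> R" for r
    using that K L.zero_mem L.one_mem L.uminus_mem
    by (auto simp: L.polys_def coeff_pCons L.map_poly_pCons L.map_one L.map_uminus split: nat.split)
  have "map_poly \<sigma> (\<Prod>r\<in>S. [:- r, 1:]) = (\<Prod>r\<in>S. [:- \<sigma> r, 1:])" if "finite S" "S \<subseteq> R" for S
    using that
  proof (induction S rule: finite_induct)
    case empty
    show ?case by (simp add: one_pCons L.map_poly_pCons L.map_one)
  next
    case (insert x S)
    have "(\<Prod>r\<in>S. [:- r, 1:]) \<in> L.polys" using insert.prems lin by (intro L.polys_prod) auto
    thus ?case using insert lin[of x] by (simp add: L.map_poly_mult del: mult_pCons_left)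
  qed
  hence "map_poly \<sigma> g = (\<Prod>r\<in>R. [:- \<sigma> r, 1:])" using finite_R by (simp add: g_def)
  also have "\<dots> = g"
    unfolding g_def using embedding_bij_betw[OF K] by (rule prod.reindex_bij_betw)
  finally have "coeff (map_poly \<sigma> g) i = coeff g i" by simp
  thus "\<sigma> (coeff (\<Prod>r\<in>R. [:- r, 1:]) i) = coeff (\<Prod>r\<in>R. [:- r, 1:]) i"
    by (simp add: coeff_map_poly L.map_zero g_def)
qed

end

section \<open>Linear relations between three conjugates\<close>

text \<open>The sign \<open>e = -1\<close> stands for \<open>a + b + c = 0\<close> and \<open>e = 1\<close> for \<open>a = b + c\<close>; a triple is
  represented by the pair \<open>(a, b)\<close>, with \<open>c = e * a - b\<close>.\<close>

locale conjugate_relation = pisot +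
  fixes e :: complex and B :: "complex \<Rightarrow> complex set"
  assumes e: "e = 1 \<or> e = -1"
    and relation: "\<exists>a\<in>R. \<exists>b\<in>R. e * a - b \<in> R"
  defines "B \<equiv> \<lambda>x. {b \<in> R. e * x - b \<in> R}"
begin

lemma norm_e: "norm e = 1" and e_Rats: "e \<in> \<rat>" and e_square: "e * e = 1"
  using e by auto

lemma embedding_relation:
  assumes "subfield_embedding K \<sigma>" "R \<subseteq> K" "a \<in> R" "b \<in> R"
  shows "\<sigma> (e * a - b) = e * \<sigma> a - \<sigma> b"
proof -
  interpret L: subfield_embedding K \<sigma> by fact
  have "a \<in> K" "b \<in> K" "e \<in> K" using assms L.Rats_subset e_Rats by auto
  thus ?thesis using e_Rats by (simp add: L.map_diff L.map_mult L.mult_mem L.map_Rats)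
qed

text \<open>An embedding taking x to y injects \<open>F x\<close> into \<open>F y\<close>, and
  transitivity provides one in each direction.\<close>

lemma card_equivariant:
  assumes F: "\<And>x. x \<in> R \<Longrightarrow> F x \<subseteq> R"
    and equiv: "\<And>K \<sigma> x z. subfield_embedding K \<sigma> \<Longrightarrow> R \<subseteq> K \<Longrightarrow> x \<in> R \<Longrightarrow> z \<in> F x \<Longrightarrow> \<sigma> z \<in> F (\<sigma> x)"
    and "x \<in> R" "y \<in> R"
  shows "card (F x) = card (F y)"
proof -
  have "card (F x) \<le> card (F y)" if xy: "x \<in> R" "y \<in> R" for x y
  proof -
    obtain K \<sigma> where K: "subfield_embedding K \<sigma>" "R \<subseteq> K" "\<sigma> x = y"
      using transitive[OF xy] by metis
    interpret L: subfield_embedding K \<sigma> by fact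
    show ?thesis
    proof (rule card_inj_on_le)
      show "inj_on \<sigma> (F x)" using F[OF xy(1)] K(2) by (intro inj_on_subset[OF L.inj_on_K]) auto
      show "\<sigma> ` F x \<subseteq> F y" using equiv[OF K(1,2) xy(1)] K(3) by auto
      show "finite (F y)" using F[OF xy(2)] finite_R finite_subset by blast
    qed
  qed
  thus ?thesis using assms(3,4) by (simp add: le_antisym)
qed

section \<open>Counting triples by position\<close>

definition n :: nat where "n = card (B (of_real \<alpha>))"

definition T :: "(complex \<times> complex) set" where "T = Sigma R B"

lemma mem_T_iff: "(a, b) \<in> T \<longleftrightarrow> a \<in> R \<and> b \<in> R \<and> e * a - b \<in> R"
  by (auto simp: T_def B_def)

lemma finite_B: "finite (B x)"
  using finite_R by (simp add: B_def)

lemma finite_T: "finite T"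
  using finite_R finite_B by (simp add: T_def)

lemma embedding_mem_T:
  assumes "subfield_embedding K \<sigma>" "R \<subseteq> K" "(a, b) \<in> T"
  shows "(\<sigma> a, \<sigma> b) \<in> T"
  using assms embedding_relation[OF assms(1,2), of a b] embedding_mem[OF assms(1,2)]
  unfolding mem_T_iff by metis

lemma card_B: "x \<in> R \<Longrightarrow> card (B x) = n"
  unfolding n_def
proof (rule card_equivariant)
  fix K \<sigma> x z assume "subfield_embedding K \<sigma>" "R \<subseteq> K" "x \<in> R" "z \<in> B x"
  thus "\<sigma> z \<in> B (\<sigma> x)" using embedding_mem_T[of K \<sigma> x z] by (simp add: T_def)
qed (auto simp: B_def alpha_mem)

lemma n_pos: "n > 0"
proof -
  obtain a b where ab: "a \<in> R" "b \<in> B a" using relation by (auto simp: B_def)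
  hence "card (B a) > 0" using finite_B card_gt_0_iff by blast
  thus ?thesis using card_B ab by simp
qed

lemma card_T: "card T = card R * n"
  using finite_R finite_B by (simp add: T_def card_SigmaI card_B)

text \<open>The fibre of \<open>T\<close> over a second entry, as \<open>B\<close> is the fibre over
  a first entry.\<close>

definition A :: "complex \<Rightarrow> complex set" where "A y = {a \<in> R. e * a - y \<in> R}"

lemma finite_A: "finite (A y)"
  using finite_R by (simp add: A_def)

lemma T_swap: "bij_betw (\<lambda>(a, b). (b, a)) T (Sigma R A)"
  by (rule bij_betwI[where g = "\<lambda>(b, a). (a, b)"]) (auto simp: mem_T_iff A_def)

lemma card_A: "y \<in> R \<Longrightarrow> card (A y) = n"
proof -
  define m where "m = card (A (of_real \<alpha>))"
  have const: "card (A y) = m" if "y \<in> R" for y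
    unfolding m_def
  proof (rule card_equivariant)
    fix K \<sigma> x z assume "subfield_embedding K \<sigma>" "R \<subseteq> K" "x \<in> R" "z \<in> A x"
    thus "\<sigma> z \<in> A (\<sigma> x)" using embedding_mem_T[of K \<sigma> z x] by (simp add: A_def mem_T_iff)
  qed (use that alpha_mem in \<open>auto simp: A_def\<close>)
  \<comment> \<open>Counting \<open>T\<close> by second entries and by first entries gives d m = d
    n.\<close>
  have "card T = card R * m"
    using bij_betw_same_card[OF T_swap] finite_R finite_A by (simp add: card_SigmaI const)
  moreover have "card R > 0" using alpha_mem finite_R card_gt_0_iff by blast
  ultimately have "m = n" using card_T by simp
  thus "y \<in> R \<Longrightarrow> card (A y) = n" using const by simp
qed

lemma T_swap': "bij_betw (\<lambda>(a, b). (a, e * a - b)) T T"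
  by (rule bij_betwI[where g = "\<lambda>(a, b). (a, e * a - b)"]) (auto simp: mem_T_iff)

text \<open>Summing c = e a - b over \<open>T\<close> gives n S = e n S - n S for the trace S, and 2
  - e is nonzero.\<close>

lemma sum_R: "\<Sum>R = 0"
proof -
  have s1: "(\<Sum>(a, b)\<in>T. a) = of_nat n * \<Sum>R"
    using finite_R finite_B
    by (simp add: T_def sum.Sigma[symmetric] card_B sum_distrib_left)
  have s2: "(\<Sum>(a, b)\<in>T. b) = of_nat n * \<Sum>R"
  proof -
    have "(\<Sum>(a, b)\<in>T. b) = (\<Sum>(b, a)\<in>Sigma R A. b)"
      using sum.reindex_bij_betw[OF T_swap, of "\<lambda>(b, a). b"] by (simp add: case_prod_unfold)
    also have "\<dots> = of_nat n * \<Sum>R"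
      using finite_R finite_A by (simp add: sum.Sigma[symmetric] card_A sum_distrib_left)
    finally show ?thesis .
  qed
  have "of_nat n * \<Sum>R = (\<Sum>(a, b)\<in>T. e * a - b)"
    using sum.reindex_bij_betw[OF T_swap', of "\<lambda>(a, b). b"] s2 by (simp add: case_prod_unfold)
  also have "\<dots> = e * (\<Sum>(a, b)\<in>T. a) - (\<Sum>(a, b)\<in>T. b)"
    by (simp add: case_prod_unfold sum_subtractf sum_distrib_left)
  also have "\<dots> = e * (of_nat n * \<Sum>R) - of_nat n * \<Sum>R" by (simp only: s1 s2)
  finally have eq: "of_nat n * \<Sum>R = e * (of_nat n * \<Sum>R) - of_nat n * \<Sum>R" .
  have "(2 - e) * (of_nat n * \<Sum>R)
      = of_nat n * \<Sum>R - (e * (of_nat n * \<Sum>R) - of_nat n * \<Sum>R)"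
    by (simp only: left_diff_distrib mult_2) simp
  also have "\<dots> = 0" unfolding eq[symmetric] by simp
  finally have "(2 - e) * (of_nat n * \<Sum>R) = 0" .
  moreover have "2 - e \<noteq> 0" using e by auto
  ultimately show ?thesis using n_pos by simp
qed

text \<open>Scaled to \<open>b + c = 1\<close> with \<open>w = b * c\<close>, the factor \<open>1 - w\<close> alone is only bounded by 1, and so is
  \<open>w\<close>, but the former is at most \<open>1 - \<bar>w\<bar>\<^sup>2\<close>; the exponent 2 makes the product at most 1/4.\<close>

definition H :: "complex \<times> complex \<Rightarrow> complex" where
  "H = (\<lambda>(a, b). let c = e * a - b in (b\<^sup>2 + b * c + c\<^sup>2) * (a * b * c)\<^sup>2)"

lemma embedding_H:
  assumes "subfield_embedding K \<sigma>" "R \<subseteq> K" "(a, b) \<in> T"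
  shows "H (a, b) \<in> K" "\<sigma> (H (a, b)) = H (\<sigma> a, \<sigma> b)"
proof -
  interpret L: subfield_embedding K \<sigma> by fact
  define c where "c = e * a - b"
  have c: "\<sigma> c = e * \<sigma> a - \<sigma> b"
    unfolding c_def using assms by (intro embedding_relation) (auto simp: mem_T_iff)
  have K: "a \<in> K" "b \<in> K" "c \<in> K" using assms by (auto simp: mem_T_iff c_def)
  have H: "H (a, b) = (b\<^sup>2 + b * c + c\<^sup>2) * (a * b * c)\<^sup>2" by (simp add: H_def Let_def c_def)
  show "H (a, b) \<in> K" unfolding H by (intro L.mult_mem L.add_mem L.power_mem K)
  show "\<sigma> (H (a, b)) = H (\<sigma> a, \<sigma> b)"
    unfolding H by (simp add: H_def Let_def c[symmetric] K L.map_mult L.map_add L.map_power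
        L.mult_mem L.add_mem L.power_mem)
qed

text \<open>Each factor is an algebraic integer, and embeddings permute the triples in
  \<open>T\<close>.\<close>

lemma prod_H_Ints: "prod H T \<in> \<int>"
proof (rule integral_if_embedding_fixed)
  show "algebraic_int (prod H T)"
  proof (rule algebraic_int_prod)
    fix t assume "t \<in> T"
    then obtain a b where t: "t = (a, b)" "a \<in> R" "b \<in> R" "e * a - b \<in> R"
      by (cases t) (auto simp: mem_T_iff)
    define c where "c = e * a - b"
    have H: "H t = (b\<^sup>2 + b * c + c\<^sup>2) * (a * b * c)\<^sup>2" by (simp add: H_def Let_def t c_def)
    have "algebraic_int a" "algebraic_int b" "algebraic_int c"
      using t algebraic_int_R by (auto simp: c_def)
    thus "algebraic_int (H t)"
      unfolding H power2_eq_square by (intro algebraic_int_mult algebraic_int_add)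
  qed
  fix K \<sigma> assume K: "subfield_embedding K \<sigma>" "R \<subseteq> K"
  interpret L: subfield_embedding K \<sigma> by fact
  define s where "s = (\<lambda>(a, b). (\<sigma> a, \<sigma> b))"
  have "inj_on \<sigma> R" using L.inj_on_K K(2) by (rule inj_on_subset)
  hence "inj_on s T" by (auto simp: inj_on_def s_def mem_T_iff)
  moreover have "s ` T \<subseteq> T" using embedding_mem_T[OF K] by (auto simp: s_def)
  ultimately have bij: "bij_betw s T T" using finite_T by (simp add: bij_betw_def endo_inj_surj)
  have "\<sigma> (prod H T) = (\<Prod>t\<in>T. \<sigma> (H t))"
    using embedding_H(1)[OF K] by (intro L.map_prod) auto
  also have "\<dots> = (\<Prod>t\<in>T. H (s t))"
    using embedding_H(2)[OF K] by (intro prod.cong) (auto simp: s_def)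
  also have "\<dots> = prod H T" using bij by (rule prod.reindex_bij_betw)
  finally show "\<sigma> (prod H T) = prod H T" .
qed

text \<open>An embedding moves the first entry to alpha. If the form vanished, b^3 = c^3 would give
  b and c equal modulus, and (b + c)^2 = b c would make that modulus alpha. Then b = c = alpha,
  where the form is 3 alpha^2.\<close>

lemma H_nonzero:
  assumes "t \<in> T"
  shows "H t \<noteq> 0"
proof
  assume H0: "H t = 0"
  obtain a0 b0 where t: "t = (a0, b0)" by (cases t)
  hence T0: "(a0, b0) \<in> T" "a0 \<in> R" using assms by (auto simp: mem_T_iff)
  obtain K \<sigma> where K: "subfield_embedding K \<sigma>" "R \<subseteq> K" "\<sigma> a0 = of_real \<alpha>"
    using transitive[OF T0(2) alpha_mem] by metis
  interpret L: subfield_embedding K \<sigma> by fact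
  define a b c where "a = complex_of_real \<alpha>" and "b = \<sigma> b0" and "c = e * a - b"
  have T: "(a, b) \<in> T" using embedding_mem_T[OF K(1,2) T0(1)] K(3) by (simp add: a_def b_def)
  hence abc: "a \<in> R" "b \<in> R" "c \<in> R" by (auto simp: mem_T_iff c_def)
  have "H (a, b) = 0"
    using embedding_H(2)[OF K(1,2) T0(1)] H0 K(3) by (simp add: t a_def b_def L.map_zero)
  hence "(b\<^sup>2 + b * c + c\<^sup>2) * (a * b * c)\<^sup>2 = 0" by (simp add: H_def Let_def c_def)
  hence P: "b\<^sup>2 + b * c + c\<^sup>2 = 0" using abc zero_not_mem by auto
  have "b + c = e * a" by (simp add: c_def)
  hence "norm a * norm a = norm ((b + c) * (b + c))" by (simp add: norm_mult norm_e)
  also have "(b + c) * (b + c) = (b\<^sup>2 + b * c + c\<^sup>2) + b * c"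
    by (simp add: algebra_simps power2_eq_square)
  also have "\<dots> = b * c" using P by simp
  finally have sq: "\<alpha> * \<alpha> = norm b * norm c" using alpha_gt_1 by (simp add: a_def norm_mult)
  have "(b - c) * (b\<^sup>2 + b * c + c\<^sup>2) = b ^ 3 - c ^ 3"
    by (simp add: algebra_simps power2_eq_square power3_eq_cube)
  hence "b ^ 3 = c ^ 3" using P by simp
  hence "norm b ^ 3 = norm c ^ 3" by (metis norm_power)
  hence eq: "norm b = norm c" by (rule power_eq_imp_eq_base) auto
  hence "(norm b)\<^sup>2 = \<alpha>\<^sup>2" using sq by (simp add: power2_eq_square)
  hence "norm b = \<alpha>" by (rule power_eq_imp_eq_base) (use alpha_gt_1 in auto)
  hence "b = a" "c = a"
    using eq norm_ge_1_imp[OF abc(2)] norm_ge_1_imp[OF abc(3)] alpha_gt_1 by (auto simp: a_def)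
  hence "3 * a\<^sup>2 = 0" using P by (simp add: power2_eq_square)
  thus False using alpha_gt_1 by (simp add: a_def)
qed

lemma norm_prod_H_ge_1: "norm (prod H T) \<ge> 1"
proof -
  obtain k where k: "prod H T = of_int k" using prod_H_Ints by (auto elim: Ints_cases)
  have "prod H T \<noteq> 0" using H_nonzero finite_T by simp
  hence "k \<noteq> 0" using k by auto
  thus ?thesis unfolding k norm_of_int by linarith
qed

text \<open>Two entries equal to alpha would make the third 0 or of modulus 2 alpha.\<close>

lemma T_alpha_unique:
  assumes "(a, b) \<in> T"
  shows "\<not> (a = of_real \<alpha> \<and> b = of_real \<alpha>)"
    and "\<not> (a = of_real \<alpha> \<and> e * a - b = of_real \<alpha>)"
    and "\<not> (b = of_real \<alpha> \<and> e * a - b = of_real \<alpha>)"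
proof -
  have abc: "a \<in> R" "b \<in> R" "e * a - b \<in> R" using assms by (auto simp: mem_T_iff)
  have "(e - 1) * of_real \<alpha> \<notin> R"
    using e zero_not_mem double_not_mem[OF alpha_mem, of "-1"] by auto
  moreover have "e * (2 * of_real \<alpha>) \<notin> R"
    using double_not_mem[OF alpha_mem norm_e e_Rats] .
  moreover have "a = e * (2 * of_real \<alpha>)" if "b = of_real \<alpha>" "e * a - b = of_real \<alpha>"
  proof -
    have "e * (e * a) = e * (2 * of_real \<alpha>)" using that by (simp add: algebra_simps)
    thus ?thesis using e_square by (simp flip: mult.assoc)
  qed
  ultimately show "\<not> (a = of_real \<alpha> \<and> b = of_real \<alpha>)"
    "\<not> (a = of_real \<alpha> \<and> e * a - b = of_real \<alpha>)"
    "\<not> (b = of_real \<alpha> \<and> e * a - b = of_real \<alpha>)"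
    using abc by (auto simp: algebra_simps)
qed

definition T\<^sub>\<alpha> :: "(complex \<times> complex) set" where
  "T\<^sub>\<alpha> = {(a, b) \<in> T. a = of_real \<alpha> \<or> b = of_real \<alpha> \<or> e * a - b = of_real \<alpha>}"

lemma card_T\<^sub>\<alpha>: "card T\<^sub>\<alpha> = 3 * n"
proof -
  define x where "x = complex_of_real \<alpha>"
  have x: "x \<in> R" using alpha_mem by (simp add: x_def)
  \<comment> \<open>The triples with alpha in first, second and third position. A triple with c =
    alpha is determined by a, since b = e a - alpha.\<close>
  define X Y Z where "X = {x} \<times> B x" and "Y = A x \<times> {x}" and "Z = (\<lambda>a. (a, e * a - x)) ` A x"
  have "T\<^sub>\<alpha> = X \<union> Y \<union> Z"
    unfolding T\<^sub>\<alpha>_def X_def Y_def Z_def x_def[symmetric]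
    using x by (auto simp: mem_T_iff A_def B_def image_iff algebra_simps)
  moreover have "card X = n" "card Y = n" using x by (simp_all add: X_def Y_def card_B card_A card_cartesian_product)
  moreover have "card Z = n"
    unfolding Z_def using x by (subst card_image) (auto simp: inj_on_def card_A)
  moreover have "X \<subseteq> T" "Y \<subseteq> T" "Z \<subseteq> T"
    using x by (auto simp: X_def Y_def Z_def mem_T_iff A_def B_def)
  hence "X \<inter> Y = {}" "(X \<union> Y) \<inter> Z = {}"
    using T_alpha_unique unfolding x_def[symmetric] by (fastforce simp: X_def Y_def Z_def)+
  moreover have "finite X" "finite Y" "finite Z"
    by (auto simp: X_def Y_def Z_def finite_A finite_B)
  ultimately show ?thesis by (simp add: card_Un_disjoint)
qed

lemma norm_H_le:
  assumes "t \<in> T"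
  shows "norm (H t) \<le> (if t \<in> T\<^sub>\<alpha> then 3 * \<alpha>\<^sup>2 else 1 / 4)"
proof -
  obtain a b where t: "t = (a, b)" by (cases t)
  define c where "c = e * a - b"
  \<comment> \<open>This turns either relation into x + b + c = 0; as e^2 = 1, the squared product
    is unchanged.\<close>
  define x where "x = - (e * a)"
  have T: "(a, b) \<in> T" using assms t by simp
  have abc: "a \<in> R" "b \<in> R" "c \<in> R" using T by (auto simp: mem_T_iff c_def)
  have sum: "x + b + c = 0" by (simp add: x_def c_def)
  have nx: "norm x = norm a" by (simp add: x_def norm_mult norm_e)
  have "(e * (a * b * c))\<^sup>2 = (e * e) * (a * b * c)\<^sup>2" by (simp add: power2_eq_square mult_ac)
  hence "(x * b * c)\<^sup>2 = (a * b * c)\<^sup>2" using e_square by (simp add: x_def mult.assoc)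
  hence H: "H t = (b\<^sup>2 + b * c + c\<^sup>2) * (x * b * c)\<^sup>2" by (simp add: H_def Let_def t c_def)
  have Hb: "H t = (x\<^sup>2 + x * c + c\<^sup>2) * (b * x * c)\<^sup>2"
    unfolding H sum_zero_quadratic_form(1)[OF sum] by (simp add: mult_ac)
  have Hc: "H t = (x\<^sup>2 + x * b + b\<^sup>2) * (c * x * b)\<^sup>2"
    unfolding H sum_zero_quadratic_form(2)[OF sum] by (simp add: mult_ac)
  note uniq = T_alpha_unique[OF T, folded c_def]
  have lt: "z \<noteq> of_real \<alpha> \<Longrightarrow> z \<in> R \<Longrightarrow> norm z \<le> 1" for z
    using norm_less_1[of z] by simp
  have n\<alpha>: "norm (complex_of_real \<alpha>) = \<alpha>" using alpha_gt_1 by simp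
  consider "a = of_real \<alpha>" | "b = of_real \<alpha>" | "c = of_real \<alpha>"
    | "a \<noteq> of_real \<alpha>" "b \<noteq> of_real \<alpha>" "c \<noteq> of_real \<alpha>" by blast
  thus ?thesis
  proof cases
    case 1
    hence "norm (H t) \<le> 3 * \<alpha>\<^sup>2"
      using sum_zero_one_large_bound[OF sum] uniq abc lt nx n\<alpha> unfolding H by auto
    thus ?thesis using 1 T by (simp add: t T\<^sub>\<alpha>_def)
  next
    case 2
    have "b + x + c = 0" using sum by (simp add: algebra_simps)
    from sum_zero_one_large_bound[OF this] have "norm (H t) \<le> 3 * \<alpha>\<^sup>2"
      using 2 uniq abc lt nx n\<alpha> unfolding Hb by auto
    thus ?thesis using 2 T by (simp add: t T\<^sub>\<alpha>_def)
  next
    case 3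
    have "c + x + b = 0" using sum by (simp add: algebra_simps)
    from sum_zero_one_large_bound[OF this] have "norm (H t) \<le> 3 * \<alpha>\<^sup>2"
      using 3 uniq abc lt nx n\<alpha> unfolding Hc by auto
    thus ?thesis using 3 T by (simp add: t T\<^sub>\<alpha>_def c_def)
  next
    case 4
    hence "norm (H t) \<le> 1 / 4"
      using sum_zero_disc_bound[OF sum] abc lt nx unfolding H by auto
    thus ?thesis using 4 by (simp add: t T\<^sub>\<alpha>_def c_def)
  qed
qed

lemma card_R_ge_3: "3 \<le> card R" and degree_bound: "4 ^ (card R - 3) \<le> (3 * \<alpha>\<^sup>2) ^ 3"
proof -
  have sub: "T\<^sub>\<alpha> \<subseteq> T" by (auto simp: T\<^sub>\<alpha>_def)
  have "3 * n \<le> card R * n" using card_mono[OF finite_T sub] by (simp add: card_T card_T\<^sub>\<alpha>)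
  thus "3 \<le> card R" using n_pos by simp
  have "1 \<le> (\<Prod>t\<in>T. norm (H t))" using norm_prod_H_ge_1 by (simp add: prod_norm)
  also have "\<dots> \<le> (\<Prod>t\<in>T. if t \<in> T\<^sub>\<alpha> then 3 * \<alpha>\<^sup>2 else 1 / 4)"
    using norm_H_le by (intro prod_mono) auto
  also have "\<dots> = (\<Prod>t\<in>T\<^sub>\<alpha>. 3 * \<alpha>\<^sup>2) * (\<Prod>t\<in>T - T\<^sub>\<alpha>. 1 / 4)"
    using finite_T sub by (subst prod.subset_diff[OF sub finite_T]) (simp add: mult.commute)
  also have "\<dots> = (3 * \<alpha>\<^sup>2) ^ (3 * n) * (1 / 4) ^ ((card R - 3) * n)"
    using finite_subset[OF sub finite_T] sub
    by (simp add: card_Diff_subset card_T card_T\<^sub>\<alpha> diff_mult_distrib)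
  finally have "4 ^ ((card R - 3) * n) \<le> (3 * \<alpha>\<^sup>2) ^ (3 * n)"
    by (simp add: power_one_over field_simps)
  \<comment> \<open>Both exponents are multiples of n, so an n-th root removes the unknown
    n.\<close>
  hence "(4 ^ (card R - 3)) ^ n \<le> ((3 * \<alpha>\<^sup>2) ^ 3) ^ n" by (simp only: power_mult)
  thus "4 ^ (card R - 3) \<le> (3 * \<alpha>\<^sup>2) ^ 3"
    by (subst (asm) power_mono_iff) (use n_pos in auto)
qed

lemma mem_B_norms:
  assumes "b \<in> B (of_real \<alpha>)"
  shows "norm b < 1" "norm (e * of_real \<alpha> - b) < 1" "b \<noteq> of_real \<alpha>" "b \<in> R"
proof -
  have T: "(of_real \<alpha>, b) \<in> T" using assms alpha_mem by (auto simp: T_def)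
  show "norm b < 1" "norm (e * of_real \<alpha> - b) < 1" "b \<noteq> of_real \<alpha>" "b \<in> R"
    using T_alpha_unique[OF T] T norm_less_1 by (auto simp: mem_T_iff)
qed

text \<open>e alpha is a sum of two conjugates in the open unit disc.\<close>

lemma alpha_less_2: "\<alpha> < 2"
proof -
  obtain b where b: "b \<in> B (of_real \<alpha>)" using n_pos unfolding n_def by (metis card.empty ex_in_conv less_irrefl)
  have "\<alpha> = norm (b + (e * of_real \<alpha> - b))" using alpha_gt_1 by (simp add: norm_mult norm_e)
  also have "\<dots> \<le> norm b + norm (e * of_real \<alpha> - b)" by (rule norm_triangle_ineq)
  also have "\<dots> < 2" using mem_B_norms[OF b] by simp
  finally show ?thesis .
qed

lemma card_R_le_8: "card R \<le> 8"
proof (rule ccontr)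
  assume "\<not> card R \<le> 8"
  have "\<alpha>\<^sup>2 < 2\<^sup>2" using alpha_less_2 alpha_gt_1 by (intro power_strict_mono) auto
  hence "(3 * \<alpha>\<^sup>2) ^ 3 < 12 ^ 3" by (intro power_strict_mono) auto
  \<comment> \<open>The cut-off 8 comes from 12^3 = 1728 < 4096 = 4^6.\<close>
  moreover have "(4 :: real) ^ 6 \<le> 4 ^ (card R - 3)"
    using \<open>\<not> card R \<le> 8\<close> by (intro power_increasing) auto
  ultimately show False using degree_bound by simp
qed

section \<open>The involution exchanging b and c\<close>

lemma B_reflect: "b \<in> B x \<longleftrightarrow> e * x - b \<in> B x"
  by (auto simp: B_def)

lemma B_reflect_neq: "x \<in> R \<Longrightarrow> b \<in> B x \<Longrightarrow> e * x - b \<noteq> b"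
proof
  assume *: "x \<in> R" "b \<in> B x" "e * x - b = b"
  hence "e * x = 2 * b" by (simp add: algebra_simps)
  hence "e * (e * x) = e * (2 * b)" by simp
  hence "x = e * (2 * b)" using e_square by (simp flip: mult.assoc)
  thus False using double_not_mem[OF _ norm_e e_Rats, of b] * by (auto simp: B_def)
qed

lemma sum_B: "2 * \<Sum>(B x) = of_nat (card (B x)) * (e * x)"
proof -
  have "bij_betw (\<lambda>b. e * x - b) (B x) (B x)"
    using B_reflect by (intro bij_betwI[where g = "\<lambda>b. e * x - b"]) auto
  hence "\<Sum>(B x) = (\<Sum>b\<in>B x. e * x - b)" by (rule sum.reindex_bij_betw[symmetric])
  also have "\<dots> = of_nat (card (B x)) * (e * x) - \<Sum>(B x)" by (simp add: sum_subtractf)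
  finally show ?thesis by (simp add: algebra_simps)
qed

text \<open>The exchange of b and c has no fixed point, because b = c would give alpha = 2 e
  b.\<close>

lemma even_n: "even n"
  unfolding n_def
proof (rule dvd_card_if_orbits[where orb = "\<lambda>b. {b, e * of_real \<alpha> - b}"])
  fix b assume b: "b \<in> B (of_real \<alpha>)"
  show "card {b, e * of_real \<alpha> - b} = 2" using B_reflect_neq[OF alpha_mem b] by (auto simp: card_insert_if)
  show "{b, e * of_real \<alpha> - b} \<subseteq> B (of_real \<alpha>)" using b B_reflect by auto
qed (auto simp: finite_B)

lemma n_ge_2: "n \<ge> 2"
  using even_n n_pos by (auto elim: evenE)

end

section \<open>The two relations\<close>

text \<open>Here \<open>q\<close> is forced to be the golden ratio and \<open>q' = 1 - q\<close> its conjugate; \<open>P\<close> and \<open>P'\<close> are then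
  conjugate integers of \<open>\<rat>(\<surd>5)\<close>, but none lies in the required box.\<close>

lemma no_integral_pair_of_cubics:
  fixes P q P' q' :: real
  assumes q: "0 < q" "q < 2" and P: "q\<^sup>2 - 1 < P" "P < 1 + q"
    and P': "\<bar>P'\<bar> < 1" and q': "\<bar>q'\<bar> < 1" "q' \<noteq> 0"
    and ints: "P + P' \<in> \<int>" "q + q' \<in> \<int>" "P * P' \<in> \<int>" "P * q' + P' * q \<in> \<int>" "q * q' \<in> \<int>"
  shows False
proof -
  obtain A m N C k where A: "P + P' = of_int A" and m: "q + q' = of_int m"
    and N: "P * P' = of_int N" and C: "P * q' + P' * q = of_int C" and k: "q * q' = of_int k"
    using ints by (metis Ints_cases)
  \<comment> \<open>q q' is a nonzero integer of modulus below 2, hence 1 or -1; then q' in the open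
    unit interval forces q > 1.\<close>
  have "\<bar>q * q'\<bar> < 2"
    using q q' mult_strict_mono[of "\<bar>q\<bar>" 2 "\<bar>q'\<bar>" 1] by (simp add: abs_mult)
  moreover have "q * q' \<noteq> 0" using q q' by simp
  ultimately have "k = 1 \<or> k = -1" unfolding k by linarith
  hence abs_1: "\<bar>q * q'\<bar> = 1" using k by auto
  have q1: "1 < q"
  proof (rule ccontr)
    assume "\<not> 1 < q"
    hence "\<bar>q\<bar> * \<bar>q'\<bar> \<le> 1 * \<bar>q'\<bar>" using q by (intro mult_right_mono) auto
    thus False using abs_1 q' unfolding abs_mult by linarith
  qed
  have qm: "q * of_int m = q\<^sup>2 + of_int k" by (simp flip: m k add: algebra_simps power2_eq_square)
  \<comment> \<open>For k = 1 the integer m = q + 1/q would lie strictly between 2 and 3, as 1 < q <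
    2.\<close>
  have "k \<noteq> 1"
  proof
    assume "k = 1"
    have "(q - 1)\<^sup>2 > 0" using q1 by simp
    hence "q * 2 < q * of_int m" using qm \<open>k = 1\<close> by (simp add: power2_eq_square algebra_simps)
    hence "m > 2" using q by simp
    have "(q - 1) * (q - 2) < 0" using q1 q by (intro mult_pos_neg) auto
    hence "q * of_int m < q * 3" using qm \<open>k = 1\<close> by (simp add: power2_eq_square algebra_simps)
    hence "m < 3" using q by simp
    thus False using \<open>m > 2\<close> by simp
  qed
  hence k: "k = -1" using \<open>k = 1 \<or> k = -1\<close> by simp
  \<comment> \<open>For k = -1 the integer m = q - 1/q lies strictly between 0 and 2, so it is
    1.\<close>
  have "1 < q * q" using q1 by (simp add: less_1_mult)
  hence "0 < q * of_int m" using qm k q1 by (simp add: power2_eq_square)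
  hence "m > 0" using q by (simp add: zero_less_mult_iff)
  have "q * (q - 2) < 0" using q by (intro mult_pos_neg) auto
  hence "q * of_int m < q * 2" using qm k by (simp add: power2_eq_square algebra_simps)
  hence "m < 2" using q by simp
  hence "m = 1" using \<open>m > 0\<close> by simp
  hence qq: "q * q = q + 1" and q'_eq: "q' = 1 - q" using qm m k by (simp_all add: power2_eq_square)
  \<comment> \<open>y is the square root of 5 and D the difference of P and its conjugate; both y D
    and D^2 are integers.\<close>
  define y D where "y = 2 * q - 1" and "D = P - P'"
  have yy: "y * y = 5" using qq by (simp add: y_def algebra_simps)
  have y: "2 < y" "y < 3"
    using yy q1 power2_less_imp_less[of 2 y] power2_less_imp_less[of y 3]
    by (auto simp: y_def power2_eq_square)
  have P'_eq: "P' = of_int A - P" using A by simp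
  have yD: "y * D = of_int (A - 2 * C)"
    using C unfolding q'_eq P'_eq by (simp add: y_def D_def P'_eq algebra_simps flip: C)
  have DD: "D * D = of_int (A * A - 4 * N)"
    by (simp add: D_def algebra_simps flip: A N)
  have "of_int (5 * (A * A - 4 * N)) = (y * y) * (D * D)" unfolding yy DD by simp
  also have "\<dots> = (y * D) * (y * D)" by (simp add: mult_ac)
  also have "\<dots> = of_int ((A - 2 * C) * (A - 2 * C))" by (simp only: yD of_int_mult)
  finally have "5 * (A * A - 4 * N) = (A - 2 * C) * (A - 2 * C)" by (simp only: of_int_eq_iff)
  \<comment> \<open>Since 5 D^2 = (y D)^2, primality of 5 makes D an integer multiple of y; the
    bounds on P and P' then leave only D = y.\<close>
  hence "5 dvd (A - 2 * C) * (A - 2 * C)" by (metis dvd_triv_left)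
  moreover have "prime (5 :: int)" by simp
  ultimately have "5 dvd A - 2 * C" by (auto simp: prime_dvd_mult_iff)
  then obtain i where i: "A - 2 * C = 5 * i" by (elim dvdE)
  have "y * D = y * (of_int i * y)" unfolding yD i using yy by (simp add: mult_ac)
  hence D: "D = of_int i * y" using y by simp
  have "D > 0" using P P' qq q1 by (simp add: D_def power2_eq_square)
  hence "i > 0" using D y by (simp add: zero_less_mult_iff)
  have "D < 2 * y" using P P' y by (simp add: D_def y_def)
  hence "i < 2" using D y by simp
  hence "i = 1" using \<open>i > 0\<close> by simp
  hence "2 * P = of_int A + y" using D A by (simp add: D_def)
  hence "1 < (of_int A :: real)" "(of_int A :: real) < 3"
    using P qq by (auto simp: y_def power2_eq_square)
  hence "A = 2" by linarith
  \<comment> \<open>A^2 - 4 N is the discriminant of X^2 - A X + N. The value 5 requires A to be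
    odd, whereas A = 2.\<close>
  have "of_int (A * A - 4 * N) = (of_int 5 :: real)" using DD D yy \<open>i = 1\<close> by simp
  hence "A * A - 4 * N = 5" by (simp only: of_int_eq_iff)
  hence "4 - 4 * N = 5" using \<open>A = 2\<close> by simp
  thus False by presburger
qed

lemma Siegel_number_eqI: "x ^ 3 - x - 1 = 0 \<Longrightarrow> x = Siegel_number"
  unfolding Siegel_number_def using the1_equality[OF Siegel_number_unique_root] by metis

lemma prod_linear_sum_zero:
  fixes r s t :: complex
  assumes "r + s + t = 0"
  shows "[:- r, 1:] * ([:- s, 1:] * [:- t, 1:]) = [:- (r * s * t), - (s\<^sup>2 + s * t + t\<^sup>2), 0, 1:]"
proof -
  have r: "r = - s - t" using assms by (simp add: algebra_simps eq_neg_iff_add_eq_0)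
  show ?thesis unfolding r by (simp add: algebra_simps power2_eq_square)
qed

lemma of_real_Ints_iff: "(of_real r :: complex) \<in> \<int> \<longleftrightarrow> r \<in> \<int>"
  by (auto elim!: Ints_cases simp flip: of_real_of_int_eq)

context conjugate_relation
begin

section \<open>The relation a = b + c\<close>

lemma not_difference_relation: "e \<noteq> 1"
proof
  assume e1: "e = 1"
  define x where "x = complex_of_real \<alpha>"
  have x: "x \<in> R" "norm x = \<alpha>" using alpha_mem alpha_gt_1 by (auto simp: x_def)
  \<comment> \<open>The elements of \<open>A x\<close> and \<open>Z\<close> are the two sides of the
    representations of alpha as a difference of conjugates.\<close>
  define Z where "Z = (\<lambda>y. y - x) ` A x"
  have A: "y \<in> R" "y - x \<in> R" if "y \<in> A x" for y
    using that unfolding A_def by (simp_all add: e1)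
  have B: "y \<in> R" "x - y \<in> R" "norm (x - y) < 1" if "y \<in> B x" for y
    using that mem_B_norms(2)[of y] by (simp_all add: B_def e1 x_def)
  have Z: "z \<in> R" "z + x \<in> R" "norm z < 1" "z \<noteq> x" if "z \<in> Z" for z
  proof -
    show *: "z \<in> R" "z + x \<in> R" using that A by (auto simp: Z_def)
    show "z \<noteq> x" using *(2) double_not_mem[OF x(1), of 1] by (metis Rats_1 mult_1 mult_2 norm_one)
    thus "norm z < 1" using * norm_less_1 by (simp add: x_def)
  qed
  \<comment> \<open>Otherwise 2 alpha = (u + alpha) + (alpha - u) would be a sum of two numbers of
    modulus below 1. This separates \<open>Z\<close>, whose elements remain conjugates after adding
    alpha, from \<open>B x\<close> and \<open>A x\<close>, which lie within distance 1 of
    alpha.\<close>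
  have no_pair: "\<not> (u + x \<in> R \<and> norm (x - u) < 1)" if "u \<in> R" for u
  proof
    assume *: "u + x \<in> R \<and> norm (x - u) < 1"
    have "u + x \<noteq> x" using that zero_not_mem by auto
    hence "norm (u + x) < 1" using * norm_less_1 by (simp add: x_def)
    moreover have "norm (2 * x) \<le> norm (u + x) + norm (x - u)"
      using norm_triangle_ineq[of "u + x" "x - u"] by (simp add: algebra_simps)
    ultimately show False using * x alpha_gt_1 by (simp add: norm_mult)
  qed
  have AZ: "norm (y - x) < 1" if "y \<in> A x" for y using Z(3)[of "y - x"] that by (auto simp: Z_def)
  define U where "U = {x} \<union> B x \<union> A x \<union> Z"
  have disj: "{x} \<inter> B x = {}" "({x} \<union> B x) \<inter> A x = {}" "({x} \<union> B x \<union> A x) \<inter> Z = {}"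
  proof -
    show "{x} \<inter> B x = {}" using mem_B_norms by (auto simp: x_def)
    have "x \<notin> A x"
    proof
      assume "x \<in> A x"
      from A(2)[OF this] show False using zero_not_mem by simp
    qed
    moreover have "y \<notin> A x" if "y \<in> B x" for y
    proof
      assume "y \<in> A x"
      from uminus_not_mem[OF A(2)[OF this]] B(2)[OF that] show False by simp
    qed
    ultimately show "({x} \<union> B x) \<inter> A x = {}" by auto
    have "y \<notin> Z" if "y \<in> B x" for y
      using no_pair[OF B(1)[OF that]] B(3)[OF that] Z(2)[of y] by blast
    moreover have "y \<notin> Z" if "y \<in> A x" for y
      using no_pair[OF A(1)[OF that]] AZ[OF that] Z(2)[of y] unfolding norm_minus_commute[of x y]
      by blast
    ultimately show "({x} \<union> B x \<union> A x) \<inter> Z = {}" using Z(4) by auto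
  qed
  have fin: "finite (B x)" "finite (A x)" "finite Z" by (auto simp: finite_B finite_A Z_def)
  have inj: "inj_on (\<lambda>y. y - x) (A x)" by (auto simp: inj_on_def)
  have "card Z = n" unfolding Z_def using inj x by (simp add: card_image card_A)
  hence card_U: "card U = 3 * n + 1"
    unfolding U_def using fin disj x by (simp add: card_Un_disjoint card_A card_B)
  have UR: "U \<subseteq> R" using A(1) B(1) Z(1) x(1) unfolding U_def by blast
  have "3 * n + 1 \<le> card R" using card_mono[OF finite_R UR] card_U by simp
  hence n: "n = 2" "card R \<ge> 7" using n_ge_2 card_R_le_8 by auto
  have "card (R - U) = card R - 7" using card_Diff_subset[of U R] UR fin card_U n by (simp add: U_def)
  hence card_rest: "card (R - U) \<le> 1" using card_R_le_8 by simp
  have "norm z \<le> 1" if "z \<in> R - U" for z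
    using that norm_less_1[of z] by (simp add: U_def x_def)
  hence "norm (\<Sum>(R - U)) \<le> of_nat (card (R - U)) * 1"
    by (intro order_trans[OF norm_sum sum_bounded_above])
  hence rest: "norm (\<Sum>(R - U)) \<le> 1" using card_rest by linarith
  have "\<Sum>R = \<Sum>(R - U) + \<Sum>U" using UR finite_R by (rule sum.subset_diff)
  also have "\<Sum>U = x + \<Sum>(B x) + \<Sum>(A x) + \<Sum>Z"
    unfolding U_def using fin disj by (simp add: sum.union_disjoint)
  also have "\<Sum>(B x) = x" using sum_B[of x] unfolding card_B[OF x(1)] n(1) by (simp add: e1)
  \<comment> \<open>The multiples of alpha cancel, as alpha + alpha - 2 alpha = 0, so the remaining
    conjugates must balance twice the sum over \<open>A x\<close>, whose elements are close to
    alpha.\<close>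
  also have "\<Sum>Z = \<Sum>(A x) - 2 * x"
    unfolding Z_def using inj x n by (simp add: sum.reindex sum_subtractf card_A)
  finally have "\<Sum>(R - U) = - (2 * \<Sum>(A x))" using sum_R by (simp add: algebra_simps eq_neg_iff_add_eq_0)
  hence "norm (2 * \<Sum>(A x)) \<le> 1" using rest by simp
  hence "Re (2 * \<Sum>(A x)) \<le> 1" by (rule order_trans[OF complex_Re_le_cmod])
  moreover have "Re y \<ge> \<alpha> - 1" if "y \<in> A x" for y
    using AZ[OF that] abs_Re_le_cmod[of "y - x"] by (simp add: x_def)
  hence "(\<Sum>y\<in>A x. Re y) \<ge> of_nat (card (A x)) * (\<alpha> - 1)" by (rule sum_bounded_below)
  hence "Re (\<Sum>(A x)) \<ge> 2 * (\<alpha> - 1)" using x n by (simp add: card_A)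
  ultimately have "\<alpha> \<le> 5 / 4" by simp
  hence "\<alpha>\<^sup>2 \<le> (5 / 4)\<^sup>2" using alpha_gt_1 by (intro power_mono) auto
  hence "(3 * \<alpha>\<^sup>2) ^ 3 \<le> (3 * (5 / 4)\<^sup>2) ^ 3" by (intro power_mono) auto
  \<comment> \<open>The degree bound fails because (75/16)^3 < 104 < 256 = 4^4.\<close>
  moreover have "(4 :: real) ^ 4 \<le> 4 ^ (card R - 3)" using n by (intro power_increasing) auto
  ultimately show False using degree_bound by (simp add: power2_eq_square power3_eq_cube)
qed

section \<open>The relation a + b + c = 0\<close>

lemma e_eq: "e = -1"
  using e not_difference_relation by simp

lemma mem_B_sym: "u \<in> R \<Longrightarrow> v \<in> B u \<Longrightarrow> u \<in> B v"
  by (simp add: B_def e_eq minus_diff_commute)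

lemma not_mem_B_self: "u \<notin> B u"
  using double_not_mem[of u "-1"] by (auto simp: B_def e_eq algebra_simps)

text \<open>Cyclic rotation acts on \<open>T\<close>; a fixed triple would have a = b = c, hence 3 a
  = 0.\<close>

lemma three_dvd: "3 dvd card R * n"
proof -
  have "3 dvd card T"
  proof (rule dvd_card_if_orbits[where orb = "\<lambda>(a, b). {(a, b), (b, - a - b), (- a - b, a)}"])
    fix t assume t: "t \<in> T"
    obtain a b where ab: "t = (a, b)" by (cases t)
    obtain c where c: "c = - a - b" by simp
    have "\<not> (a = b \<and> b = c)"
    proof
      assume *: "a = b \<and> b = c"
      have "3 * a = a - (- a - a)" by simp
      also have "\<dots> = 0" using * c by simp
      finally have "a = 0" by simp
      thus False using t zero_not_mem by (auto simp: ab mem_T_iff)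
    qed
    thus "card (case t of (a, b) \<Rightarrow> {(a, b), (b, - a - b), (- a - b, a)}) = 3"
      unfolding ab prod.case c[symmetric] by (auto simp: card_insert_if)
    show "(case t of (a, b) \<Rightarrow> {(a, b), (b, - a - b), (- a - b, a)}) \<subseteq> T"
      using t unfolding ab by (auto simp: mem_T_iff) (auto simp: e_eq)
    show "t \<in> (case t of (a, b) \<Rightarrow> {(a, b), (b, - a - b), (- a - b, a)})" by (simp add: ab)
    fix t' assume "t' \<in> (case t of (a, b) \<Rightarrow> {(a, b), (b, - a - b), (- a - b, a)})"
    thus "(case t' of (a, b) \<Rightarrow> {(a, b), (b, - a - b), (- a - b, a)})
        = (case t of (a, b) \<Rightarrow> {(a, b), (b, - a - b), (- a - b, a)})"
      by (auto simp: ab)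
  qed (rule finite_T)
  thus ?thesis by (simp add: card_T)
qed

lemma degree_cases: "n = 2 \<and> (card R = 3 \<or> card R = 6)"
proof -
  define x where "x = complex_of_real \<alpha>"
  have x: "x \<in> R" "norm x = \<alpha>" using alpha_mem alpha_gt_1 by (auto simp: x_def)
  define U where "U = insert x (B x)"
  have "x \<notin> B x" by (rule not_mem_B_self)
  hence card_U: "card U = n + 1" using x by (simp add: U_def finite_B card_B)
  have UR: "U \<subseteq> R" using x by (auto simp: U_def B_def)
  have le: "n + 1 \<le> card R" using card_mono[OF finite_R UR] card_U by simp
  \<comment> \<open>Here at most one conjugate lies outside alpha and \<open>B x\<close>, so the
    rest sums to modulus at most 1. The vanishing trace makes twice that sum (n - 2) alpha, whose
    modulus exceeds 2.\<close>
  have "\<not> (n \<ge> 4 \<and> card R \<le> n + 2)"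
  proof
    assume *: "n \<ge> 4 \<and> card R \<le> n + 2"
    have "card (R - U) = card R - (n + 1)"
      using card_Diff_subset[of U R] UR card_U by (simp add: U_def finite_B)
    hence "card (R - U) \<le> 1" using * by linarith
    have "norm z \<le> 1" if "z \<in> R - U" for z
      using that norm_less_1[of z] by (simp add: U_def x_def)
    hence "norm (\<Sum>(R - U)) \<le> of_nat (card (R - U)) * 1"
      by (intro order_trans[OF norm_sum sum_bounded_above])
    hence rest: "norm (\<Sum>(R - U)) \<le> 1" using \<open>card (R - U) \<le> 1\<close> by linarith
    have "\<Sum>R = \<Sum>(R - U) + \<Sum>U" using UR finite_R by (rule sum.subset_diff)
    also have "\<Sum>U = x + \<Sum>(B x)" using \<open>x \<notin> B x\<close> finite_B by (simp add: U_def)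
    finally have "\<Sum>(R - U) = - x - \<Sum>(B x)"
      using sum_R by (simp add: eq_diff_eq eq_neg_iff_add_eq_0 add_ac)
    hence "2 * \<Sum>(R - U) = - (2 * x) - 2 * \<Sum>(B x)" by simp
    also have "\<dots> = of_real (real n - 2) * x"
      using sum_B[of x] card_B[OF x(1)] by (simp add: e_eq algebra_simps)
    finally have "norm (2 * \<Sum>(R - U)) = \<bar>real n - 2\<bar> * norm x"
      by (simp only: norm_mult norm_of_real)
    moreover have "\<bar>real n - 2\<bar> = real n - 2" using * by simp
    ultimately have "(real n - 2) * \<alpha> \<le> 2" using rest x by (simp add: norm_mult)
    moreover have "2 * \<alpha> \<le> (real n - 2) * \<alpha>" using * alpha_gt_1 by (intro mult_right_mono) auto
    ultimately show False using alpha_gt_1 by simp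
  qed
  moreover have "n \<in> {2, 3, 4, 5, 6, 7}" "card R \<in> {3, 4, 5, 6, 7, 8}"
    using n_ge_2 card_R_ge_3 card_R_le_8 le by auto
  \<comment> \<open>For n = 2, 3 must divide d. For n = 4 only d = 7 and d = 8 remain, and 3 does
    not divide 4 d. For n = 6 the same two degrees are excluded by the trace.\<close>
  ultimately show ?thesis using le even_n three_dvd by auto
qed

text \<open>Complex conjugation preserves {b, c}, so b and c are real or conjugate to each other.
  Either way (1 + b)(1 + c) = 1 - alpha + w is positive, which gives the lower bound on w.\<close>

lemma alpha_triple:
  obtains b c w where "B (of_real \<alpha>) = {b, c}" "b \<noteq> c" "of_real \<alpha> + b + c = 0"
    "b * c = of_real w" "\<alpha> - 1 < w" "w < 1"
proof -
  have "card (B (of_real \<alpha>)) = 2" using degree_cases by (simp add: n_def)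
  then obtain b c' where "B (of_real \<alpha>) = {b, c'}" "b \<noteq> c'" by (auto simp: card_2_iff)
  define c where "c = - of_real \<alpha> - b"
  have bB: "b \<in> B (of_real \<alpha>)" using \<open>B _ = _\<close> by simp
  have "c \<in> B (of_real \<alpha>)" using B_reflect[of b "of_real \<alpha>"] bB by (simp add: c_def e_eq)
  moreover have "c \<noteq> b" using B_reflect_neq[OF alpha_mem bB] by (simp add: c_def e_eq)
  ultimately have B: "B (of_real \<alpha>) = {b, c}" using \<open>B _ = {b, c'}\<close> by auto
  have nb: "norm b < 1" "norm c < 1" using mem_B_norms B by auto
  have "cnj b \<in> B (of_real \<alpha>)"
  proof -
    have "b \<in> R" "c \<in> R" using B by (auto simp: B_def)
    hence "cnj b \<in> R" "cnj c \<in> R" using cnj_mem by auto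
    thus ?thesis by (simp add: B_def e_eq c_def)
  qed
  hence "cnj b = b \<or> cnj b = c" using B by simp
  hence "\<exists>w. b * c = of_real w \<and> \<alpha> - 1 < w \<and> w < 1"
  proof
    assume "cnj b = b"
    then obtain \<beta> where \<beta>: "b = of_real \<beta>" by (metis Reals_cnj_iff Reals_cases)
    define \<gamma> where "\<gamma> = - \<alpha> - \<beta>"
    have c: "c = of_real \<gamma>" by (simp add: c_def \<gamma>_def \<beta>)
    have "\<bar>\<beta>\<bar> < 1" "\<bar>\<gamma>\<bar> < 1" using nb by (auto simp: \<beta> c)
    hence "(1 + \<beta>) * (1 + \<gamma>) > 0" "\<bar>\<beta> * \<gamma>\<bar> < 1 * 1"
      unfolding abs_mult by (intro mult_pos_pos mult_strict_mono; simp)+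
    thus ?thesis by (intro exI[of _ "\<beta> * \<gamma>"]) (auto simp: \<beta> c \<gamma>_def algebra_simps)
  next
    assume cnj: "cnj b = c"
    hence "Re b = - \<alpha> - Re b" by (simp add: c_def complex_eq_iff)
    have "1 + b \<noteq> 0" using nb by (auto simp: add_eq_0_iff)
    hence "(norm (1 + b))\<^sup>2 > 0" by simp
    also have "(norm (1 + b))\<^sup>2 = 1 + 2 * Re b + (norm b)\<^sup>2"
      by (simp add: cmod_power2) (simp add: power2_eq_square algebra_simps)
    finally have "\<alpha> - 1 < (norm b)\<^sup>2" using \<open>Re b = - \<alpha> - Re b\<close> by simp
    moreover have "(norm b)\<^sup>2 < 1" using nb by (simp add: power_less_one_iff)
    moreover have "b * c = of_real ((norm b)\<^sup>2)" using complex_norm_square[of b] cnj by simp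
    ultimately show ?thesis by blast
  qed
  thus ?thesis using that[OF B \<open>c \<noteq> b\<close>[symmetric]] by (auto simp: c_def)
qed

lemma alpha_eq_Siegel: "\<alpha> = Siegel_number"
proof -
  define x where "x = complex_of_real \<alpha>"
  obtain b c w where B: "B x = {b, c}" "b \<noteq> c" and sum: "x + b + c = 0"
    and w: "b * c = of_real w" "\<alpha> - 1 < w" "w < 1"
    using alpha_triple unfolding x_def by metis
  define P q where "P = \<alpha>\<^sup>2 - w" and "q = \<alpha> * w"
  have ne: "x \<noteq> b" "x \<noteq> c" using not_mem_B_self[of x] B by auto
  have mem: "x \<in> R" "b \<in> R" "c \<in> R" using B alpha_mem by (auto simp: x_def B_def)
  have q: "x * b * c = of_real q" by (simp add: x_def q_def mult.assoc w)
  have "b\<^sup>2 + b * c + c\<^sup>2 = (x + b + c) * (b + c - x) + x\<^sup>2 - b * c"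
    by (simp add: algebra_simps power2_eq_square)
  also have "\<dots> = of_real P" unfolding sum w(1) by (simp add: x_def P_def)
  finally have P: "b\<^sup>2 + b * c + c\<^sup>2 = of_real P" .
  have cubic: "[:- x, 1:] * ([:- b, 1:] * [:- c, 1:]) = [:- of_real q, - of_real P, 0, 1:]"
    by (simp only: prod_linear_sum_zero[OF sum] P q)
  have "0 < q" using w alpha_gt_1 by (simp add: q_def)
  have "q < 2"
    using w alpha_gt_1 alpha_less_2 mult_strict_mono[of \<alpha> 2 w 1] by (simp add: q_def)
  \<comment> \<open>P < 1 + q says that X^3 - P X - q is negative at -1; this is the bound w > alpha
    - 1 multiplied by alpha + 1.\<close>
  have "(\<alpha> + 1) * (\<alpha> - 1) < (\<alpha> + 1) * w" using w alpha_gt_1 by (intro mult_strict_left_mono) auto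
  hence "P < 1 + q" by (simp add: P_def q_def algebra_simps power2_eq_square)
  have "card R = 3 \<or> card R = 6" using degree_cases by simp
  thus ?thesis
  proof
    assume "card R = 3"
    moreover have "card {x, b, c} = 3" using ne B by simp
    ultimately have "R = {x, b, c}" using mem finite_R by (intro card_subset_eq[symmetric]) auto
    hence "(\<Prod>r\<in>R. [:- r, 1:]) = [:- of_real q, - of_real P, 0, 1:]"
      using ne B(2) cubic by (simp del: mult_pCons_left mult_pCons_right)
    hence "q \<in> \<int>" "P \<in> \<int>"
      using prod_linear_coeff_Ints[of 0] prod_linear_coeff_Ints[of 1]
      by (simp_all add: of_real_Ints_iff flip: of_real_minus)
    hence "q = 1" using \<open>0 < q\<close> \<open>q < 2\<close> by (auto elim!: Ints_cases)
    have "1 < \<alpha>\<^sup>2" using alpha_gt_1 by (simp add: one_less_power)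
    hence "0 < P" using w by (simp add: P_def)
    hence "P = 1" using \<open>P \<in> \<int>\<close> \<open>P < 1 + q\<close> \<open>q = 1\<close> by (auto elim!: Ints_cases)
    have "\<alpha> ^ 3 = \<alpha> * (P + w)" by (simp add: P_def power2_eq_square power3_eq_cube)
    hence "\<alpha> ^ 3 - \<alpha> - 1 = 0" using \<open>q = 1\<close> \<open>P = 1\<close> by (simp add: q_def algebra_simps)
    thus ?thesis by (rule Siegel_number_eqI)
  next
    assume card_R: "card R = 6"
    have card_2: "card (B u) = 2" if "u \<in> R" for u using that degree_cases card_B by simp
    \<comment> \<open>As \<open>B u\<close> has two elements, each of x, b, c has exactly the other
      two as partners. Hence a zero-sum triple of conjugates that starts outside {x, b, c} never
      enters it.\<close>
    have B_triple: "B u \<subseteq> {x, b, c}" if "u \<in> {x, b, c}" for u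
    proof -
      have perm: "B u = {v, w}" if "u \<in> R" "v \<in> R" "w \<in> R" "v \<noteq> w" "u + v + w = 0" for u v w
      proof (rule card_subset_eq[symmetric])
        have "- u - v = w" "- u - w = v" using that(5) by (simp_all add: add_eq_0_iff)
        thus "{v, w} \<subseteq> B u" using that by (auto simp: B_def e_eq)
      qed (use that card_2 finite_B in auto)
      have "b + x + c = 0" "c + x + b = 0" using sum by (simp_all only: add_ac)
      hence "B b = {x, c}" "B c = {x, b}" using perm[of b x c] perm[of c x b] mem ne by blast+
      thus ?thesis using that B by auto
    qed
    have "\<not> R \<subseteq> {x, b, c}" using card_R card_mono[of "{x, b, c}" R] ne B by auto
    then obtain r where r: "r \<in> R" "r \<notin> {x, b, c}" by blast
    have "B r \<noteq> {}" using card_2[OF r(1)] by auto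
    then obtain s where s: "s \<in> B r" by blast
    define t where "t = - r - s"
    have t: "t \<in> B r" using iffD1[OF B_reflect s] by (simp add: t_def e_eq)
    have "t \<noteq> s" using B_reflect_neq[OF r(1) s] by (simp add: t_def e_eq)
    have st: "s \<in> R" "t \<in> R" "s \<noteq> r" "t \<noteq> r"
    proof -
      show "s \<in> R" "t \<in> R" using s t by (simp_all add: B_def)
      show "s \<noteq> r" "t \<noteq> r" using s t not_mem_B_self[of r] by metis+
    qed
    have st': "s \<notin> {x, b, c}" "t \<notin> {x, b, c}"
      using mem_B_sym[OF r(1) s] mem_B_sym[OF r(1) t] B_triple r(2) by blast+
    have distinct: "x \<notin> {b, c, r, s, t}" "b \<notin> {c, r, s, t}" "c \<notin> {r, s, t}" "r \<notin> {s, t}" "s \<notin> {t}"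
      using ne B(2) r(2) st(3,4) st' \<open>t \<noteq> s\<close> by blast+
    hence "card {x, b, c, r, s, t} = 6" by simp
    hence R: "R = {x, b, c, r, s, t}"
      using card_R mem r st finite_R by (intro card_subset_eq[symmetric]) auto
    have sum': "r + s + t = 0" by (simp add: t_def)
    define f g where "f = s\<^sup>2 + s * t + t\<^sup>2" and "g = r * s * t"
    have lt: "norm r < 1" "norm s < 1" "norm t < 1"
      using norm_less_1 r st st' by (simp_all add: x_def)
    hence "norm f < 1" unfolding f_def by (rule sum_zero_open_disc_quadratic_form[OF sum'])
    have "norm g = norm r * (norm s * norm t)" by (simp add: g_def norm_mult mult.assoc)
    also have "\<dots> \<le> norm r * 1" using lt by (intro mult_left_mono mult_le_one) auto
    finally have "norm g < 1" using lt by simp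
    have "(\<Prod>r\<in>R. [:- r, 1:])
        = ([:- x, 1:] * ([:- b, 1:] * [:- c, 1:])) * ([:- r, 1:] * ([:- s, 1:] * [:- t, 1:]))"
      unfolding R using distinct
      by (simp add: mult.assoc del: mult_pCons_left mult_pCons_right)
    also have "\<dots> = [:- of_real q, - of_real P, 0, 1:] * [:- g, - f, 0, 1:]"
      unfolding cubic prod_linear_sum_zero[OF sum'] f_def g_def ..
    also have "\<dots> = [:of_real q * g, of_real P * g + f * of_real q, of_real P * f,
        - (of_real q + g), - (of_real P + f), 0, 1:]"
      by (simp add: algebra_simps)
    finally have prod_eq: "(\<Prod>r\<in>R. [:- r, 1:]) = \<dots>" .
    have ints: "of_real q * g \<in> \<int>" "of_real P * g + f * of_real q \<in> \<int>" "of_real P * f \<in> \<int>"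
      "of_real q + g \<in> \<int>" "of_real P + f \<in> \<int>"
      using prod_linear_coeff_Ints[of 0] prod_linear_coeff_Ints[of 1] prod_linear_coeff_Ints[of 2]
        prod_linear_coeff_Ints[of 3] prod_linear_coeff_Ints[of 4]
      unfolding prod_eq by (simp_all add: eval_nat_numeral flip: minus_add_distrib)
    \<comment> \<open>The second cubic X^3 - f X - g is real, because f and g differ from integers
      by the real numbers P and q.\<close>
    obtain k l where "of_real q + g = of_int k" "of_real P + f = of_int l"
      using ints(4,5) by (auto elim!: Ints_cases)
    then obtain q' P' where q': "g = of_real q'" and P': "f = of_real P'"
      using that[of "of_int k - q" "of_int l - P"] by (auto simp: algebra_simps)
    have False
    proof (rule no_integral_pair_of_cubics)
      show "0 < q" "q < 2" "P < 1 + q" by fact+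
      \<comment> \<open>q^2 is at most alpha^2 = P + w, which is below P + 1.\<close>
      have "(\<alpha> * w)\<^sup>2 \<le> \<alpha>\<^sup>2" using w alpha_gt_1 by (intro power_mono) auto
      thus "q\<^sup>2 - 1 < P" using w by (simp add: P_def q_def)
      show "\<bar>P'\<bar> < 1" "\<bar>q'\<bar> < 1" using \<open>norm f < 1\<close> \<open>norm g < 1\<close> by (auto simp: P' q')
      have "g \<noteq> 0" using r st zero_not_mem by (auto simp: g_def)
      thus "q' \<noteq> 0" by (simp add: q')
      show "P + P' \<in> \<int>" "q + q' \<in> \<int>" "P * P' \<in> \<int>" "P * q' + P' * q \<in> \<int>" "q * q' \<in> \<int>"
        using ints unfolding P' q' by (simp_all flip: of_real_add of_real_mult add: of_real_Ints_iff)
    qed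
    thus ?thesis ..
  qed
qed

end

section \<open>Both claims from the common setting\<close>

lemma conjugate_relationI:
  assumes "Pisot_number \<alpha>" "e = 1 \<or> e = -1" "a \<in> conjugates_over_Q (of_real \<alpha>)"
    "b \<in> conjugates_over_Q (of_real \<alpha>)" "e * a - b \<in> conjugates_over_Q (of_real \<alpha>)"
  shows "conjugate_relation \<alpha> e"
  using assms by unfold_locales blast+

theorem theorem1p4:
  shows "(\<forall>\<alpha> :: real. Pisot_number \<alpha> \<longrightarrow>
            (\<exists>\<alpha>\<^sub>1 \<in> conjugates_over_Q (complex_of_real \<alpha>).
             \<exists>\<alpha>\<^sub>2 \<in> conjugates_over_Q (complex_of_real \<alpha>).
             \<exists>\<alpha>\<^sub>3 \<in> conjugates_over_Q (complex_of_real \<alpha>). \<alpha>\<^sub>1 + \<alpha>\<^sub>2 + \<alpha>\<^sub>3 = 0) \<longrightarrow>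
            \<alpha> = Siegel_number)
       \<and> \<not> (\<exists>\<alpha> :: real. Pisot_number \<alpha> \<and>
            (\<exists>\<alpha>\<^sub>1 \<in> conjugates_over_Q (complex_of_real \<alpha>).
             \<exists>\<alpha>\<^sub>2 \<in> conjugates_over_Q (complex_of_real \<alpha>).
             \<exists>\<alpha>\<^sub>3 \<in> conjugates_over_Q (complex_of_real \<alpha>). \<alpha>\<^sub>1 = \<alpha>\<^sub>2 + \<alpha>\<^sub>3))"
proof (intro conjI allI impI notI)
  fix \<alpha> :: real
  assume \<alpha>: "Pisot_number \<alpha>"
  assume "\<exists>\<alpha>\<^sub>1 \<in> conjugates_over_Q (complex_of_real \<alpha>).
    \<exists>\<alpha>\<^sub>2 \<in> conjugates_over_Q (complex_of_real \<alpha>).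
    \<exists>\<alpha>\<^sub>3 \<in> conjugates_over_Q (complex_of_real \<alpha>). \<alpha>\<^sub>1 + \<alpha>\<^sub>2 + \<alpha>\<^sub>3 = 0"
  then obtain a b c where abc: "a \<in> conjugates_over_Q (complex_of_real \<alpha>)"
    "b \<in> conjugates_over_Q (complex_of_real \<alpha>)" "c \<in> conjugates_over_Q (complex_of_real \<alpha>)"
    "a + b + c = 0" by blast
  have "-1 * a - b = c" using abc(4) by (simp add: add_eq_0_iff)
  hence "conjugate_relation \<alpha> (-1)" using \<alpha> abc by (intro conjugate_relationI[of \<alpha> _ a b]) auto
  thus "\<alpha> = Siegel_number" by (rule conjugate_relation.alpha_eq_Siegel)
next
  assume "\<exists>\<alpha> :: real. Pisot_number \<alpha> \<and>
    (\<exists>\<alpha>\<^sub>1 \<in> conjugates_over_Q (complex_of_real \<alpha>).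
     \<exists>\<alpha>\<^sub>2 \<in> conjugates_over_Q (complex_of_real \<alpha>).
     \<exists>\<alpha>\<^sub>3 \<in> conjugates_over_Q (complex_of_real \<alpha>). \<alpha>\<^sub>1 = \<alpha>\<^sub>2 + \<alpha>\<^sub>3)"
  then obtain \<alpha> a b c where \<alpha>: "Pisot_number \<alpha>" and abc: "a \<in> conjugates_over_Q (complex_of_real \<alpha>)"
    "b \<in> conjugates_over_Q (complex_of_real \<alpha>)" "c \<in> conjugates_over_Q (complex_of_real \<alpha>)"
    "a = b + c" by blast
  have "1 * a - b = c" using abc(4) by simp
  hence "conjugate_relation \<alpha> 1" using \<alpha> abc by (intro conjugate_relationI[of \<alpha> _ a b]) auto
  thus False using conjugate_relation.not_difference_relation by blast
qed

end
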